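(* Let $\mathcal X$ be a finite set with $n$ elements, let $w(x,y)=w(y,x)\ge 0$ ($x,y\in\mathcal X$, $w(x,x)=0$) be the weights of a non-oriented weighted graph on $\mathcal X$, let $L$ be its graph Laplacian, and let $0=\lambda_0\le\lambda_1\le\dots\le\lambda_{n-1}$ be the eigenvalues of $-L$ counted with multiplicity. Let $q>0$, let $l\ge 1$ be an integer, let $\Phi_{0,q},\dots,\Phi_{l-1,q}$ be independent Kirchhoff forests with rate $q$, and for $0\le k\le l$ let $\xi_q^k=\{x\in\mathcal X: R^k(x)=x\}$, where $R^0(x)=x$ and $R^{k+1}(x)=\rho_{R^k(x)}(\Phi_{k,q})$ for $0\le k<l$. Then for all $0\le k\le l$, $$\mathbb E\bigl[|\xi_q^k|\bigr]=\sum_{j<n}\left(\frac{q}{q+\lambda_j}\right)^k .$$ In addition, $$\mathbb P\bigl(x,y\in\xi_q^k\bigr)\le \mathbb P\bigl(x\in\xi_q^k\bigr)\,\mathbb P\bigl(y\in\xi_q^k\bigr),\qquad x\ne y\in\mathcal X,$$ so that $$\mathrm{Var}\bigl(|\xi_q^k|\bigr)\le\mathbb E\bigl[|\xi_q^k|\bigr].$$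
   Context: Edges and arrows: $x\neq y$ are connected by an edge if and only if $w(x,y)>0$; with such an edge are associated two oriented arrows $(x,y)$ (leaving $x$, pointing to $y$) and $(y,x)$. Put $w(x)=\sum_{y\ne x}w(x,y)$. The graph Laplacian $L$ is the symmetric matrix with $L_{x,y}=w(x,y)$ for $x\ne y$ and $L_{x,x}=-w(x)$. A rooted spanning forest is a set $\phi$ of arrows such that (i) at most one arrow of $\phi$ leaves each node of $\mathcal X$, and (ii) no oriented loop can be closed by following arrows of $\phi$. A node that no arrow of $\phi$ leaves is a root of $\phi$; $\rho(\phi)$ is the set of roots. For $x\in\mathcal X$, $\rho_x(\phi)$ denotes the root of the tree of $\phi$ that covers $x$, i.e. the root reached by following the arrows of $\phi$ from $x$. For $q>0$, a Kirchhoff forest with rate $q$ is a random rooted spanning forest $\Phi_q$ such that for every rooted spanning forest $\phi$, $$\mathbb P(\Phi_q=\phi)=\frac{q^{|\rho(\phi)|}\prod_{(x,y)\in\phi}w(x,y)}{Z(q)},$$ where $Z(q)=\sum_{\phi}q^{|\rho(\phi)|}\prod_{(x,y)\in\phi}w(x,y)$, the sum being over all rooted spanning forests. *)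

theory Defs
  imports "HOL-Probability.Probability" "Jordan_Normal_Form.Char_Poly"
begin

definition arrows :: "'a set \<Rightarrow> ('a \<Rightarrow> 'a \<Rightarrow> real) \<Rightarrow> ('a \<times> 'a) set" where
  "arrows X w = {(x, y). x \<in> X \<and> y \<in> X \<and> x \<noteq> y \<and> w x y > 0}"

definition laplacian :: "'a set \<Rightarrow> ('a \<Rightarrow> 'a \<Rightarrow> real) \<Rightarrow> 'a \<Rightarrow> 'a \<Rightarrow> real" where
  "laplacian X w x y = (if x = y then - (\<Sum>z\<in>X - {x}. w x z) else w x y)"

(* Matrices are indexed by {..<n}, so the rows and columns follow an enumeration
   node 0, ..., node (n - 1) of the vertices. *)
definition laplacian_mat ::
    "'a set \<Rightarrow> ('a \<Rightarrow> 'a \<Rightarrow> real) \<Rightarrow> nat \<Rightarrow> (nat \<Rightarrow> 'a) \<Rightarrow> real mat" where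
  "laplacian_mat X w n node = Matrix.mat n n (\<lambda>(i, j). laplacian X w (node i) (node j))"

(* single_valued: at most one arrow leaves each node; acyclic: no oriented loop,
   the two-arrow loop through a single edge included. *)
definition rooted_forests :: "'a set \<Rightarrow> ('a \<Rightarrow> 'a \<Rightarrow> real) \<Rightarrow> ('a \<times> 'a) set set" where
  "rooted_forests X w = {\<phi>. \<phi> \<subseteq> arrows X w \<and> single_valued \<phi> \<and> acyclic \<phi>}"

definition forest_roots :: "'a set \<Rightarrow> ('a \<times> 'a) set \<Rightarrow> 'a set" where
  "forest_roots X \<phi> = {x \<in> X. \<nexists>y. (x, y) \<in> \<phi>}"

definition forest_root :: "'a set \<Rightarrow> ('a \<times> 'a) set \<Rightarrow> 'a \<Rightarrow> 'a" where
  "forest_root X \<phi> x = (THE r. r \<in> forest_roots X \<phi> \<and> (x, r) \<in> \<phi>\<^sup>*)"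

definition forest_weight ::
    "'a set \<Rightarrow> ('a \<Rightarrow> 'a \<Rightarrow> real) \<Rightarrow> real \<Rightarrow> ('a \<times> 'a) set \<Rightarrow> real" where
  "forest_weight X w q \<phi> = q ^ card (forest_roots X \<phi>) * (\<Prod>(x, y)\<in>\<phi>. w x y)"

definition partition_function :: "'a set \<Rightarrow> ('a \<Rightarrow> 'a \<Rightarrow> real) \<Rightarrow> real \<Rightarrow> real" where
  "partition_function X w q = (\<Sum>\<phi>\<in>rooted_forests X w. forest_weight X w q \<phi>)"

definition kirchhoff_forest ::
    "'w measure \<Rightarrow> 'a set \<Rightarrow> ('a \<Rightarrow> 'a \<Rightarrow> real) \<Rightarrow> real \<Rightarrow> ('w \<Rightarrow> ('a \<times> 'a) set) \<Rightarrow> bool" where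
  "kirchhoff_forest M X w q \<Phi> \<longleftrightarrow>
     \<Phi> \<in> measurable M (count_space (rooted_forests X w)) \<and>
     (\<forall>\<phi>\<in>rooted_forests X w.
        measure M {\<omega> \<in> space M. \<Phi> \<omega> = \<phi>} = forest_weight X w q \<phi> / partition_function X w q)"

primrec iter_root :: "'a set \<Rightarrow> (nat \<Rightarrow> ('a \<times> 'a) set) \<Rightarrow> nat \<Rightarrow> 'a \<Rightarrow> 'a" where
  "iter_root X F 0 x = x"
| "iter_root X F (Suc k) x = forest_root X (F k) (iter_root X F k x)"

definition fixed_nodes :: "'a set \<Rightarrow> (nat \<Rightarrow> ('a \<times> 'a) set) \<Rightarrow> nat \<Rightarrow> 'a set" where
  "fixed_nodes X F k = {x \<in> X. iter_root X F k x = x}"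

end

theory Submission
  imports Defs "Jordan_Normal_Form.Schur_Decomposition"
begin

text \<open>
  Write \<open>K(x,a)\<close> for the probability that \<open>a\<close> is the root of \<open>x\<close>. Splitting forests according to the
  arrow leaving a single node \<open>x\<close> gives \<open>(q - L) K = q\<close>, so \<open>K\<close> has the eigenvalues
  \<open>q / (q + \<lambda>\<^sub>j)\<close>; since \<open>R\<^sup>k\<close> is a Markov chain with kernel \<open>K\<close>, the mean of \<open>|\<xi>\<^sup>k|\<close> is the trace
  of \<open>K\<^sup>k\<close>.

  For the correlation inequality, consider forests whose root set is forced to contain \<open>B\<close>, with
  root probabilities \<open>K\<^sub>B\<close>. The minimum principle shows that \<open>K\<^sub>B(y,b)\<close> does not increase when a
  node other than \<open>b\<close> is added to \<open>B\<close>. Following the arrow leaving \<open>x\<close> and inducting on the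
  complement of \<open>B\<close> yields \<open>P(\<rho>\<^sub>x = a, \<rho>\<^sub>y = b) \<le> K(x,a) K(y,b)\<close> for \<open>a \<noteq> b\<close>. Two trajectories
  that merge never separate again, hence this one-step bound propagates to
  \<open>P(R\<^sup>k(x) = a, R\<^sup>k(y) = b) \<le> K\<^sup>k(x,a) K\<^sup>k(y,b)\<close>, and \<open>a = x\<close>, \<open>b = y\<close> is the claim.
\<close>

subsection \<open>Trace of the powers of a resolvent\<close>

lemma index_mult_mat_sum:
  assumes "A \<in> carrier_mat n n" "B \<in> carrier_mat n n" "i < n" "j < n"
  shows "(A * B) $$ (i, j) = (\<Sum>m<n. A $$ (i, m) * B $$ (m, j))"
  using assms by (auto simp: scalar_prod_def atLeast0LessThan intro!: sum.cong)

lemma trace_mult_commute: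
  fixes A B :: "'a :: comm_semiring_0 mat"
  assumes "A \<in> carrier_mat n n" "B \<in> carrier_mat n n"
  shows "(\<Sum>i<n. (A * B) $$ (i, i)) = (\<Sum>i<n. (B * A) $$ (i, i))"
proof -
  have "(\<Sum>i<n. (A * B) $$ (i, i)) = (\<Sum>i<n. \<Sum>m<n. A $$ (i, m) * B $$ (m, i))"
    by (intro sum.cong refl index_mult_mat_sum) (use assms in auto)
  also have "\<dots> = (\<Sum>m<n. \<Sum>i<n. B $$ (m, i) * A $$ (i, m))"
    by (subst sum.swap) (simp add: mult.commute)
  also have "\<dots> = (\<Sum>m<n. (B * A) $$ (m, m))"
    by (intro sum.cong refl index_mult_mat_sum[symmetric]) (use assms in auto)
  finally show ?thesis .
qed

text \<open>Induction from the last row upwards: once the rows of \<open>U\<close> below row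
  \<open>i\<close> vanish left of the diagonal, only the term \<open>m = i\<close> survives in entry
  \<open>(i, j)\<close> of \<open>T * U\<close> for \<open>j \<le> i\<close>. The case
  \<open>j = i\<close> shows that the diagonal entry of \<open>T\<close> is nonzero, and then
  \<open>j < i\<close> forces a zero in \<open>U\<close>.\<close>

lemma upper_triangular_right_inverse:
  fixes T U :: "'a :: field mat"
  assumes T: "T \<in> carrier_mat n n" and U: "U \<in> carrier_mat n n"
    and tri: "\<And>i j. j < i \<Longrightarrow> i < n \<Longrightarrow> T $$ (i, j) = 0"
    and inv: "T * U = q \<cdot>\<^sub>m 1\<^sub>m n" and q: "q \<noteq> 0"
    and i: "i < n"
  shows "T $$ (i, i) * U $$ (i, i) = q \<and> (\<forall>j<i. U $$ (i, j) = 0)"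
  using i
proof (induction "n - i" arbitrary: i rule: less_induct)
  case less
  have below: "U $$ (m, j) = 0" if "i < m" "m < n" "j < m" for m j
    using less.hyps[of m] that by auto
  have row: "(T * U) $$ (i, j) = T $$ (i, i) * U $$ (i, j)" if "j \<le> i" for j
  proof -
    have "(T * U) $$ (i, j) = (\<Sum>m<n. T $$ (i, m) * U $$ (m, j))"
      using T U less.prems that by (intro index_mult_mat_sum) auto
    also have "\<dots> = (\<Sum>m\<in>{i}. T $$ (i, m) * U $$ (m, j))"
    proof (rule sum.mono_neutral_right)
      show "\<forall>m\<in>{..<n} - {i}. T $$ (i, m) * U $$ (m, j) = 0"
      proof
        fix m assume m: "m \<in> {..<n} - {i}"
        then consider "m < i" | "i < m" by fastforce
        then show "T $$ (i, m) * U $$ (m, j) = 0"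
          by cases (use m tri less.prems below that in auto)
      qed
    qed (use less.prems in auto)
    finally show ?thesis by simp
  qed
  have diag: "T $$ (i, i) * U $$ (i, i) = q" using row[of i] less.prems by (simp add: inv)
  moreover have "U $$ (i, j) = 0" if "j < i" for j
  proof -
    have "T $$ (i, i) * U $$ (i, j) = 0" using row[of j] that less.prems by (simp add: inv)
    then show ?thesis using diag q by auto
  qed
  ultimately show ?case by blast
qed

text \<open>The two claims feed each other: for \<open>j \<le> i\<close>, terms with
  \<open>m < i\<close> vanish by triangularity of the power and terms with \<open>m > i\<close> by
  triangularity of \<open>U\<close>, so only \<open>m = i\<close> is left.\<close>

lemma pow_mat_upper_triangular:
  fixes U :: "'a :: comm_semiring_1 mat"
  assumes U: "U \<in> carrier_mat n n" and tri: "\<And>i j. j < i \<Longrightarrow> i < n \<Longrightarrow> U $$ (i, j) = 0"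
  shows "\<forall>i<n. (U ^\<^sub>m k) $$ (i, i) = U $$ (i, i) ^ k \<and> (\<forall>j<i. (U ^\<^sub>m k) $$ (i, j) = 0)"
proof (induction k)
  case 0
  then show ?case using U by auto
next
  case (Suc k)
  have Uk: "U ^\<^sub>m k \<in> carrier_mat n n" by (rule pow_carrier_mat[OF U])
  show ?case
  proof (intro allI impI)
    fix i assume i: "i < n"
    have row: "(U ^\<^sub>m Suc k) $$ (i, j) = (U ^\<^sub>m k) $$ (i, i) * U $$ (i, j)" if "j \<le> i" for j
    proof -
      have "(U ^\<^sub>m Suc k) $$ (i, j) = (\<Sum>m<n. (U ^\<^sub>m k) $$ (i, m) * U $$ (m, j))"
        using index_mult_mat_sum[OF Uk U i] that i by simp
      also have "\<dots> = (\<Sum>m\<in>{i}. (U ^\<^sub>m k) $$ (i, m) * U $$ (m, j))"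
      proof (rule sum.mono_neutral_right)
        show "\<forall>m\<in>{..<n} - {i}. (U ^\<^sub>m k) $$ (i, m) * U $$ (m, j) = 0"
        proof
          fix m assume m: "m \<in> {..<n} - {i}"
          then consider "m < i" | "i < m" by fastforce
          then show "(U ^\<^sub>m k) $$ (i, m) * U $$ (m, j) = 0"
            by cases (use m tri i Suc that in auto)
        qed
      qed (use i in auto)
      finally show ?thesis by simp
    qed
    show "(U ^\<^sub>m Suc k) $$ (i, i) = U $$ (i, i) ^ Suc k \<and> (\<forall>j<i. (U ^\<^sub>m Suc k) $$ (i, j) = 0)"
    proof (intro conjI allI impI)
      show "(U ^\<^sub>m Suc k) $$ (i, i) = U $$ (i, i) ^ Suc k"
        using row[of i] Suc i by (simp add: mult.commute)
      show "(U ^\<^sub>m Suc k) $$ (i, j) = 0" if "j < i" for j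
        using row[of j] tri[OF that i] that by simp
    qed
  qed
qed

text \<open>Conjugating \<open>K\<close> by the matrix \<open>S\<close> that brings \<open>A\<close>
  to its Schur form \<open>T\<close> gives \<open>U\<close> with \<open>(q + T) * U = q\<close>. So
  \<open>U\<close> is triangular with diagonal \<open>q / (q + lam j)\<close>, and the trace of a
  power is invariant under conjugation.\<close>

lemma trace_pow_resolvent:
  fixes A K :: "real mat"
  assumes A: "A \<in> carrier_mat n n" and K: "K \<in> carrier_mat n n"
    and cp: "char_poly A = (\<Prod>j<n. [:- lam j, 1:])"
    and res: "(q \<cdot>\<^sub>m 1\<^sub>m n + A) * K = q \<cdot>\<^sub>m 1\<^sub>m n" and q: "q \<noteq> 0"
  shows "(\<Sum>i<n. (K ^\<^sub>m k) $$ (i, i)) = (\<Sum>j<n. (q / (q + lam j)) ^ k)"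
proof -
  \<comment> \<open>The Schur decomposition takes the eigenvalues as a list and puts them on the
    diagonal in that order, so position \<open>i\<close> carries \<open>lam i\<close>.\<close>
  define es where "es = map lam [0..<n]"
  have "char_poly A = (\<Prod>e\<leftarrow>es. [:- e, 1:])"
    unfolding cp es_def
    using prod.distinct_set_conv_list[of "[0..<n]" "\<lambda>j. [:- lam j, 1:]"]
    by (simp add: comp_def lessThan_atLeast0)
  moreover obtain T S S' where TSS: "schur_decomposition A es = (T, S, S')"
    by (cases "schur_decomposition A es")
  ultimately have wit: "similar_mat_wit A T S S'" and tri: "upper_triangular T" and diag: "diag_mat T = es"
    using schur_decomposition[OF A] by auto
  note wD = similar_mat_witD2[OF A wit]
  have T: "T \<in> carrier_mat n n" and S: "S \<in> carrier_mat n n" and S': "S' \<in> carrier_mat n n"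
    and SS': "S * S' = 1\<^sub>m n" and S'S: "S' * S = 1\<^sub>m n" and AT: "A = S * T * S'"
    using wD by auto
  have diagT: "T $$ (i, i) = lam i" if "i < n" for i
  proof -
    have "diag_mat T ! i = T $$ (i, i)" using that T by (simp add: diag_mat_def)
    then show ?thesis using diag that by (simp add: es_def)
  qed
  define D where "D = q \<cdot>\<^sub>m 1\<^sub>m n + T"
  define U where "U = S' * K * S"
  have D: "D \<in> carrier_mat n n" and U: "U \<in> carrier_mat n n"
    using T S S' K by (auto simp: D_def U_def)
  have I: "q \<cdot>\<^sub>m 1\<^sub>m n \<in> carrier_mat n n" by simp
  have sum_eq: "S * D * S' = q \<cdot>\<^sub>m 1\<^sub>m n + A"
  proof -
    have "S * D * S' = (S * (q \<cdot>\<^sub>m 1\<^sub>m n) + S * T) * S'"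
      unfolding D_def using mult_add_distrib_mat[OF S I T] by simp
    also have "\<dots> = S * (q \<cdot>\<^sub>m 1\<^sub>m n) * S' + S * T * S'"
      using S S' T by (intro add_mult_distrib_mat) auto
    also have "S * (q \<cdot>\<^sub>m 1\<^sub>m n) * S' = q \<cdot>\<^sub>m 1\<^sub>m n"
      using S mult_smult_distrib[OF S one_carrier_mat, of q] mult_smult_assoc_mat[OF S S', of q] SS'
      by simp
    finally show ?thesis using AT by simp
  qed
  have DU: "D * U = q \<cdot>\<^sub>m 1\<^sub>m n"
  proof -
    have "D * U = S' * (S * D * S' * K) * S"
    proof -
      have "S' * (S * D * S' * K) * S = (S' * S) * D * (S' * K * S)"
        using S S' D K by (simp add: assoc_mult_mat[of _ n n _ n _ n])
      then show ?thesis using D by (simp add: S'S U_def)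
    qed
    also have "\<dots> = q \<cdot>\<^sub>m 1\<^sub>m n"
      unfolding sum_eq res
      using S' mult_smult_distrib[OF S' one_carrier_mat, of q] mult_smult_assoc_mat[OF S' S, of q] S'S
      by simp
    finally show ?thesis .
  qed
  have Dtri: "D $$ (i, j) = 0" if "j < i" "i < n" for i j
    using that tri T by (auto simp: D_def)
  have Ddiag: "D $$ (i, i) = q + lam i" if "i < n" for i
    using that T by (simp add: D_def diagT)
  have inv: "D $$ (i, i) * U $$ (i, i) = q \<and> (\<forall>j<i. U $$ (i, j) = 0)" if "i < n" for i
    by (rule upper_triangular_right_inverse[OF D U _ DU q that]) (rule Dtri)
  \<comment> \<open>The product being \<open>q \<noteq> 0\<close> rules out
    \<open>q + lam i = 0\<close>, so the quotient is a genuine one.\<close>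
  have Udiag: "U $$ (i, i) = q / (q + lam i)" if "i < n" for i
  proof -
    have "(q + lam i) * U $$ (i, i) = q" using inv[OF that] Ddiag[OF that] by simp
    then show ?thesis using q by (metis mult_eq_0_iff nonzero_mult_div_cancel_left)
  qed
  have "K = S * U * S'"
  proof -
    have "S * U * S' = (S * S') * K * (S * S')"
      using S S' K by (simp add: U_def assoc_mult_mat[of _ n n _ n _ n])
    then show ?thesis using K by (simp add: SS')
  qed
  then have "similar_mat_wit K U S S'"
    using S S' K U SS' S'S by (intro similar_mat_witI[of _ _ n]) auto
  then have pow: "K ^\<^sub>m k = S * U ^\<^sub>m k * S'" by (rule similar_mat_wit_pow_id)
  have Uk: "U ^\<^sub>m k \<in> carrier_mat n n" by (rule pow_carrier_mat[OF U])
  have Upow: "\<forall>i<n. (U ^\<^sub>m k) $$ (i, i) = U $$ (i, i) ^ k \<and> (\<forall>j<i. (U ^\<^sub>m k) $$ (i, j) = 0)"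
    by (rule pow_mat_upper_triangular[OF U]) (use inv in auto)
  have "(\<Sum>i<n. (K ^\<^sub>m k) $$ (i, i)) = (\<Sum>i<n. (S' * (S * U ^\<^sub>m k)) $$ (i, i))"
    unfolding pow using S S' Uk by (intro trace_mult_commute) auto
  also have "S' * (S * U ^\<^sub>m k) = U ^\<^sub>m k"
    using assoc_mult_mat[OF S' S Uk] left_mult_one_mat[OF Uk] S'S by simp
  also have "(\<Sum>i<n. (U ^\<^sub>m k) $$ (i, i)) = (\<Sum>i<n. (q / (q + lam i)) ^ k)"
    using Upow Udiag by (intro sum.cong) auto
  finally show ?thesis .
qed

subsection \<open>Rooted forests\<close>

context
  fixes X :: "'a set" and w :: "'a \<Rightarrow> 'a \<Rightarrow> real"
  assumes fin: "finite X"
begin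

lemma finite_arrows: "finite (arrows X w)"
  by (rule finite_subset[of _ "X \<times> X"]) (auto simp: arrows_def fin)

lemma finite_rooted_forests: "finite (rooted_forests X w)"
  by (rule finite_subset[of _ "Pow (arrows X w)"]) (auto simp: rooted_forests_def finite_arrows)

text \<open>Two nodes reached from \<open>x\<close> along a single-valued relation are comparable,
  and no arrow leaves a root, so comparable roots coincide. This resolves the description operator
  in \<open>forest_root\<close>.\<close>

lemma forest_root_eqI:
  assumes "\<phi> \<in> rooted_forests X w" "r \<in> forest_roots X \<phi>" "(x, r) \<in> \<phi>\<^sup>*"
  shows "forest_root X \<phi> x = r"
  unfolding forest_root_def
proof (rule the_equality)
  show "r \<in> forest_roots X \<phi> \<and> (x, r) \<in> \<phi>\<^sup>*" using assms by simp
  fix s assume s: "s \<in> forest_roots X \<phi> \<and> (x, s) \<in> \<phi>\<^sup>*"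
  have "single_valued \<phi>" using assms by (simp add: rooted_forests_def)
  then have "(r, s) \<in> \<phi>\<^sup>* \<or> (s, r) \<in> \<phi>\<^sup>*"
    using single_valued_confluent assms(3) s by metis
  then show "s = r"
    using s assms(2) by (auto simp: forest_roots_def elim: converse_rtranclE)
qed

text \<open>A finite acyclic relation has a well-founded converse, so following arrows from
  \<open>x\<close> must stop.\<close>

lemma forest_root_exists:
  assumes "\<phi> \<in> rooted_forests X w" "x \<in> X"
  shows "\<exists>r. r \<in> forest_roots X \<phi> \<and> (x, r) \<in> \<phi>\<^sup>*"
proof -
  have "finite \<phi>" using assms finite_arrows finite_subset by (auto simp: rooted_forests_def)
  then have "wf (\<phi>\<inverse>)"
    using assms by (intro finite_acyclic_wf_converse) (auto simp: rooted_forests_def)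
  then show ?thesis using assms(2)
  proof (induction x rule: wf_induct_rule)
    case (less x)
    show ?case
    proof (cases "\<exists>y. (x, y) \<in> \<phi>")
      case True
      then obtain y where y: "(x, y) \<in> \<phi>" by blast
      then have "y \<in> X" using assms by (auto simp: rooted_forests_def arrows_def)
      then show ?thesis using less.IH[of y] y by (meson converse.intros converse_rtrancl_into_rtrancl)
    next
      case False
      then show ?thesis using less.prems by (auto simp: forest_roots_def)
    qed
  qed
qed

lemma forest_root_props:
  assumes "\<phi> \<in> rooted_forests X w" "x \<in> X"
  shows "forest_root X \<phi> x \<in> forest_roots X \<phi>" "(x, forest_root X \<phi> x) \<in> \<phi>\<^sup>*"
  using forest_root_exists[OF assms] forest_root_eqI[OF assms(1)] by auto

lemma forest_root_in:
  assumes "\<phi> \<in> rooted_forests X w" "x \<in> X"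
  shows "forest_root X \<phi> x \<in> X"
  using forest_root_props[OF assms] by (auto simp: forest_roots_def)

lemma forest_root_of_root:
  assumes "\<phi> \<in> rooted_forests X w" "x \<in> forest_roots X \<phi>"
  shows "forest_root X \<phi> x = x"
  using forest_root_eqI[OF assms] by auto

text \<open>The condition on \<open>z\<close> says that \<open>z\<close> lies outside the tree of
  \<open>x\<close>, so the new arrow closes no loop. It hangs the whole tree of \<open>x\<close>
  below \<open>z\<close>: exactly the nodes formerly rooted at \<open>x\<close> change root.\<close>

lemma
  assumes \<psi>: "\<psi> \<in> rooted_forests X w" and x: "x \<in> forest_roots X \<psi>"
    and z: "z \<in> X" "w x z > 0" "forest_root X \<psi> z \<noteq> x"
  shows insert_arrow_forest: "insert (x, z) \<psi> \<in> rooted_forests X w"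
    and forest_roots_insert_arrow: "forest_roots X (insert (x, z) \<psi>) = forest_roots X \<psi> - {x}"
    and forest_root_insert_arrow: "\<And>y. y \<in> X \<Longrightarrow> forest_root X (insert (x, z) \<psi>) y =
          (if forest_root X \<psi> y = x then forest_root X \<psi> z else forest_root X \<psi> y)"
proof -
  let ?\<phi> = "insert (x, z) \<psi>"
  have xX: "x \<in> X" and x_root: "(x, u) \<notin> \<psi>" for u using x by (auto simp: forest_roots_def)
  have "z \<noteq> x" using z(3) forest_root_of_root[OF \<psi> x] by auto
  moreover have "(z, x) \<notin> \<psi>\<^sup>*" using forest_root_eqI[OF \<psi> x] z(3) by blast
  moreover have "single_valued ?\<phi>"
    using \<psi> x_root by (auto simp: rooted_forests_def single_valued_def)
  ultimately show \<phi>: "?\<phi> \<in> rooted_forests X w"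
    using \<psi> xX z by (auto simp: rooted_forests_def arrows_def)
  show roots: "forest_roots X ?\<phi> = forest_roots X \<psi> - {x}"
    by (auto simp: forest_roots_def)
  have mono: "\<psi>\<^sup>* \<subseteq> ?\<phi>\<^sup>*" by (rule rtrancl_mono) auto
  fix y assume y: "y \<in> X"
  show "forest_root X ?\<phi> y =
          (if forest_root X \<psi> y = x then forest_root X \<psi> z else forest_root X \<psi> y)"
  proof (cases "forest_root X \<psi> y = x")
    case True
    then have "(y, x) \<in> ?\<phi>\<^sup>*" using forest_root_props(2)[OF \<psi> y] mono by auto
    also have "(x, z) \<in> ?\<phi>" by simp
    also have "(z, forest_root X \<psi> z) \<in> ?\<phi>\<^sup>*" using forest_root_props(2)[OF \<psi> z(1)] mono by auto
    finally show ?thesis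
      using forest_root_eqI[OF \<phi>] forest_root_props(1)[OF \<psi> z(1)] True z(3) roots by auto
  next
    case False
    then show ?thesis
      using forest_root_eqI[OF \<phi>] forest_root_props[OF \<psi> y] roots mono by auto
  qed
qed

end

subsection \<open>Forests with forced roots\<close>

locale killed_graph =
  fixes X :: "'a set" and w :: "'a \<Rightarrow> 'a \<Rightarrow> real" and q :: real
  assumes fin: "finite X"
    and w_nonneg: "\<And>x y. x \<in> X \<Longrightarrow> y \<in> X \<Longrightarrow> w x y \<ge> 0"
    and q_pos: "q > 0"
begin

section \<open>Weighted sums over forests, decomposed at the arrow leaving one node\<close>

definition forests_rooted :: "'a set \<Rightarrow> ('a \<times> 'a) set set" where
  "forests_rooted B = {\<phi> \<in> rooted_forests X w. B \<subseteq> forest_roots X \<phi>}"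

definition forest_sum :: "'a set \<Rightarrow> (('a \<times> 'a) set \<Rightarrow> real) \<Rightarrow> real" where
  "forest_sum B f = (\<Sum>\<phi>\<in>forests_rooted B. forest_weight X w q \<phi> * f \<phi>)"

abbreviation root :: "('a \<times> 'a) set \<Rightarrow> 'a \<Rightarrow> 'a" where
  "root \<equiv> forest_root X"

lemma finite_forests_rooted: "finite (forests_rooted B)"
  using finite_rooted_forests[OF fin] by (simp add: forests_rooted_def)

lemma forest_weight_nonneg: "\<phi> \<in> rooted_forests X w \<Longrightarrow> forest_weight X w q \<phi> \<ge> 0"
  unfolding forest_weight_def
  by (intro mult_nonneg_nonneg prod_nonneg)
     (use q_pos in \<open>auto simp: rooted_forests_def arrows_def intro: less_imp_le\<close>)

text \<open>One arrow is gained and one root is lost, which is where the \<open>1 / q\<close> comes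
  from.\<close>

lemma forest_weight_insert_arrow:
  assumes "\<psi> \<in> rooted_forests X w" "x \<in> forest_roots X \<psi>"
    and "z \<in> X" "w x z > 0" "root \<psi> z \<noteq> x"
  shows "forest_weight X w q (insert (x, z) \<psi>) = forest_weight X w q \<psi> * (w x z / q)"
proof -
  have roots: "forest_roots X (insert (x, z) \<psi>) = forest_roots X \<psi> - {x}"
    by (rule forest_roots_insert_arrow[OF fin assms])
  have "finite (forest_roots X \<psi>)" using fin by (auto simp: forest_roots_def)
  then have card: "card (forest_roots X \<psi>) = Suc (card (forest_roots X (insert (x, z) \<psi>)))"
    unfolding roots using assms(2) card_Suc_Diff1 by metis
  have "finite \<psi>" "(x, z) \<notin> \<psi>"
    using assms finite_subset[OF _ finite_arrows[OF fin]]
    by (auto simp: rooted_forests_def forest_roots_def)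
  then show ?thesis using q_pos by (simp add: forest_weight_def card)
qed

text \<open>The conclusions are the conditions under which \<open>(x, z)\<close> may be inserted, so
  removal and insertion are inverse to each other.\<close>

lemma remove_arrow:
  assumes \<phi>: "\<phi> \<in> rooted_forests X w" "(x, z) \<in> \<phi>"
  shows "\<phi> - {(x, z)} \<in> rooted_forests X w" "x \<in> forest_roots X (\<phi> - {(x, z)})"
    "z \<in> X" "w x z > 0" "root (\<phi> - {(x, z)}) z \<noteq> x"
proof -
  let ?\<psi> = "\<phi> - {(x, z)}"
  show \<psi>: "?\<psi> \<in> rooted_forests X w"
    using \<phi> by (auto simp: rooted_forests_def single_valued_def intro: acyclic_subset)
  show "x \<in> forest_roots X ?\<psi>" "z \<in> X" "w x z > 0"
    using \<phi> by (auto simp: rooted_forests_def arrows_def forest_roots_def single_valued_def)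
  have "acyclic (insert (x, z) ?\<psi>)" using \<phi> by (simp add: insert_absorb rooted_forests_def del: acyclic_insert)
  then have "(z, x) \<notin> ?\<psi>\<^sup>*" using acyclic_insert[of x z ?\<psi>] by blast
  then show "root ?\<psi> z \<noteq> x" using forest_root_props(2)[OF fin \<psi> \<open>z \<in> X\<close>] by auto
qed

text \<open>Either \<open>x\<close> is a root, which gives the term \<open>f \<psi>\<close>, or a
  unique arrow \<open>(x, z)\<close> leaves it. Deleting that arrow is a bijection onto pairs of a
  forest with \<open>x\<close> forced to be a root and a node \<open>z\<close> outside the tree of
  \<open>x\<close>.\<close>

lemma forest_sum_split:
  assumes x: "x \<in> X" "x \<notin> B"
  shows "forest_sum B f = forest_sum (insert x B)
    (\<lambda>\<psi>. f \<psi> + (\<Sum>z\<in>X. w x z / q * of_bool (root \<psi> z \<noteq> x) * f (insert (x, z) \<psi>)))"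
proof -
  let ?W = "forest_weight X w q"
  let ?S = "SIGMA \<psi>:forests_rooted (insert x B). {z \<in> X. w x z > 0 \<and> root \<psi> z \<noteq> x}"
  let ?h = "\<lambda>(\<psi>, z). insert (x, z) \<psi>"
  have eq: "forests_rooted B = forests_rooted (insert x B) \<union> ?h ` ?S"
  proof (intro equalityI subsetI)
    fix \<phi> assume \<phi>: "\<phi> \<in> forests_rooted B"
    show "\<phi> \<in> forests_rooted (insert x B) \<union> ?h ` ?S"
    proof (cases "x \<in> forest_roots X \<phi>")
      case True
      then show ?thesis using \<phi> by (auto simp: forests_rooted_def)
    next
      case False
      then obtain z where z: "(x, z) \<in> \<phi>" using x by (auto simp: forest_roots_def)
      note r = remove_arrow[OF _ z]
      have "(\<phi> - {(x, z)}, z) \<in> ?S"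
        using \<phi> r by (auto simp: forests_rooted_def forest_roots_def)
      moreover have "\<phi> = ?h (\<phi> - {(x, z)}, z)" using z by auto
      ultimately show ?thesis by blast
    qed
  next
    fix \<phi> assume "\<phi> \<in> forests_rooted (insert x B) \<union> ?h ` ?S"
    then show "\<phi> \<in> forests_rooted B"
    proof
      assume "\<phi> \<in> ?h ` ?S"
      then obtain \<psi> z where "\<phi> = insert (x, z) \<psi>" "\<psi> \<in> forests_rooted (insert x B)"
        "z \<in> X" "w x z > 0" "root \<psi> z \<noteq> x" by auto
      then show ?thesis
        using x insert_arrow_forest[OF fin, of \<psi> w x z] forest_roots_insert_arrow[OF fin, of \<psi> w x z]
        by (auto simp: forests_rooted_def)
    qed (auto simp: forests_rooted_def)
  qed
  have disj: "forests_rooted (insert x B) \<inter> ?h ` ?S = {}"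
    by (auto simp: forests_rooted_def forest_roots_def)
  have inj: "inj_on ?h ?S"
  proof (rule inj_onI)
    fix p p' assume p: "p \<in> ?S" "p' \<in> ?S" "?h p = ?h p'"
    obtain \<psi> z \<psi>' z' where [simp]: "p = (\<psi>, z)" "p' = (\<psi>', z')" by fastforce
    have no: "(x, u) \<notin> \<psi>" "(x, u) \<notin> \<psi>'" for u
      using p by (auto simp: forests_rooted_def forest_roots_def)
    have "insert (x, z) \<psi> = insert (x, z') \<psi>'" using p(3) by simp
    then show "p = p'" using no by (auto simp: insert_eq_iff split: if_splits)
  qed
  have "forest_sum B f = forest_sum (insert x B) f + (\<Sum>\<phi>\<in>?h ` ?S. ?W \<phi> * f \<phi>)"
    unfolding forest_sum_def eq
    by (rule sum.union_disjoint) (use disj finite_forests_rooted fin in auto)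
  also have "(\<Sum>\<phi>\<in>?h ` ?S. ?W \<phi> * f \<phi>) = (\<Sum>(\<psi>, z)\<in>?S. ?W (insert (x, z) \<psi>) * f (insert (x, z) \<psi>))"
    by (subst sum.reindex[OF inj]) (simp add: case_prod_unfold)
  also have "\<dots> = (\<Sum>(\<psi>, z)\<in>?S. ?W \<psi> * (w x z / q) * f (insert (x, z) \<psi>))"
    by (intro sum.cong) (auto simp: forest_weight_insert_arrow forests_rooted_def)
  also have "\<dots> = (\<Sum>\<psi>\<in>forests_rooted (insert x B).
      \<Sum>z\<in>{z \<in> X. w x z > 0 \<and> root \<psi> z \<noteq> x}. ?W \<psi> * (w x z / q) * f (insert (x, z) \<psi>))"
    by (rule sum.Sigma[symmetric]) (auto simp: finite_forests_rooted fin)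
  also have "\<dots> = (\<Sum>\<psi>\<in>forests_rooted (insert x B).
      ?W \<psi> * (\<Sum>z\<in>X. w x z / q * of_bool (root \<psi> z \<noteq> x) * f (insert (x, z) \<psi>)))"
  proof (intro sum.cong refl)
    fix \<psi>
    \<comment> \<open>Summing over all of \<open>X\<close> adds only terms killed by a zero weight
      or by the indicator.\<close>
    have "(\<Sum>z\<in>{z \<in> X. w x z > 0 \<and> root \<psi> z \<noteq> x}. ?W \<psi> * (w x z / q) * f (insert (x, z) \<psi>))
        = (\<Sum>z\<in>X. ?W \<psi> * (w x z / q * of_bool (root \<psi> z \<noteq> x) * f (insert (x, z) \<psi>)))"
      using w_nonneg[OF x(1)] by (intro sum.mono_neutral_cong_left) (auto simp: fin less_le)
    then show "(\<Sum>z\<in>{z \<in> X. w x z > 0 \<and> root \<psi> z \<noteq> x}. ?W \<psi> * (w x z / q) * f (insert (x, z) \<psi>))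
        = ?W \<psi> * (\<Sum>z\<in>X. w x z / q * of_bool (root \<psi> z \<noteq> x) * f (insert (x, z) \<psi>))"
      by (simp add: sum_distrib_left)
  qed
  finally show ?thesis by (simp add: forest_sum_def sum.distrib distrib_left)
qed

lemma forests_rooted_root:
  assumes "\<phi> \<in> forests_rooted B" "x \<in> B"
  shows "root \<phi> x = x"
  using assms forest_root_of_root[OF fin, of \<phi> w x] by (auto simp: forests_rooted_def)

lemma forest_sum_cong:
  "(\<And>\<phi>. \<phi> \<in> forests_rooted B \<Longrightarrow> f \<phi> = g \<phi>) \<Longrightarrow> forest_sum B f = forest_sum B g"
  unfolding forest_sum_def by (intro sum.cong) auto

lemma forest_sum_mono:
  "(\<And>\<phi>. \<phi> \<in> forests_rooted B \<Longrightarrow> f \<phi> \<le> g \<phi>) \<Longrightarrow> forest_sum B f \<le> forest_sum B g"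
  unfolding forest_sum_def
  by (intro sum_mono mult_left_mono) (auto simp: forests_rooted_def forest_weight_nonneg)

lemma forest_sum_zero [simp]: "forest_sum B (\<lambda>_. 0) = 0"
  by (simp add: forest_sum_def)

lemma forest_sum_add: "forest_sum B (\<lambda>\<phi>. f \<phi> + g \<phi>) = forest_sum B f + forest_sum B g"
  by (simp add: forest_sum_def distrib_left sum.distrib)

lemma forest_sum_cmult: "forest_sum B (\<lambda>\<phi>. c * f \<phi>) = c * forest_sum B f"
  by (simp add: forest_sum_def sum_distrib_left mult_ac)

lemma forest_sum_sum: "forest_sum B (\<lambda>\<phi>. \<Sum>z\<in>A. f z \<phi>) = (\<Sum>z\<in>A. forest_sum B (f z))"
  unfolding forest_sum_def sum_distrib_left by (rule sum.swap)

text \<open>Rewrites \<open>f\<close> through the updated root map. Premise \<open>g\<close> may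
  assume that the insertion is a legal forest, because in the remaining cases the weight or the
  indicator is zero.\<close>

lemma forest_sum_split_cong:
  assumes x: "x \<in> X" "x \<notin> B"
    and g: "\<And>\<psi> z. \<psi> \<in> forests_rooted (insert x B) \<Longrightarrow> z \<in> X \<Longrightarrow>
        insert (x, z) \<psi> \<in> rooted_forests X w \<Longrightarrow> root \<psi> z \<noteq> x \<Longrightarrow>
        (\<And>y. y \<in> X \<Longrightarrow> root (insert (x, z) \<psi>) y = (if root \<psi> y = x then root \<psi> z else root \<psi> y)) \<Longrightarrow>
        f (insert (x, z) \<psi>) = g \<psi> z"
  shows "forest_sum B f = forest_sum (insert x B)
    (\<lambda>\<psi>. f \<psi> + (\<Sum>z\<in>X. w x z / q * of_bool (root \<psi> z \<noteq> x) * g \<psi> z))"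
  unfolding forest_sum_split[OF x]
proof (intro forest_sum_cong arg_cong2[of _ _ _ _ "(+)"] refl sum.cong)
  fix \<psi> z assume \<psi>: "\<psi> \<in> forests_rooted (insert x B)" and z: "z \<in> X"
  show "w x z / q * of_bool (root \<psi> z \<noteq> x) * f (insert (x, z) \<psi>)
      = w x z / q * of_bool (root \<psi> z \<noteq> x) * g \<psi> z"
  proof (cases "w x z > 0 \<and> root \<psi> z \<noteq> x")
    case True
    have \<psi>': "\<psi> \<in> rooted_forests X w" "x \<in> forest_roots X \<psi>"
      using \<psi> by (auto simp: forests_rooted_def)
    show ?thesis
      using g[OF \<psi> z insert_arrow_forest[OF fin \<psi>' z] _ forest_root_insert_arrow[OF fin \<psi>' z]] True
      by simp
  next
    case False
    then show ?thesis using w_nonneg[OF x(1) z] by auto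
  qed
qed

section \<open>Unnormalised root probabilities and the resolvent equation\<close>

definition total :: "'a set \<Rightarrow> real" where
  "total B = forest_sum B (\<lambda>_. 1)"

text \<open>Dividing by \<open>total B\<close> gives the conditional root probability when all of
  \<open>B\<close> are roots. Left unnormalised, these sums satisfy linear identities between
  \<open>B\<close> and \<open>insert x B\<close>.\<close>

definition root_sum :: "'a set \<Rightarrow> 'a \<Rightarrow> 'a \<Rightarrow> real" where
  "root_sum B x a = forest_sum B (\<lambda>\<phi>. of_bool (root \<phi> x = a))"

definition pair_sum :: "'a set \<Rightarrow> 'a \<Rightarrow> 'a \<Rightarrow> 'a \<Rightarrow> 'a \<Rightarrow> real" where
  "pair_sum B x a y b = forest_sum B (\<lambda>\<phi>. of_bool (root \<phi> x = a) * of_bool (root \<phi> y = b))"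

text \<open>The empty forest makes every node a root and has positive weight.\<close>

lemma total_pos: assumes "B \<subseteq> X" shows "total B > 0"
proof -
  have e: "{} \<in> forests_rooted B"
    using assms by (auto simp: forests_rooted_def rooted_forests_def forest_roots_def acyclic_def)
  have "0 < forest_weight X w q {}" using q_pos by (simp add: forest_weight_def)
  also have "\<dots> \<le> total B"
    unfolding total_def forest_sum_def mult_1_right
    by (rule member_le_sum[OF e _ finite_forests_rooted])
       (auto simp: forests_rooted_def forest_weight_nonneg)
  finally show ?thesis .
qed

lemma root_sum_nonneg: "root_sum B x a \<ge> 0"
  using forest_sum_mono[of B "\<lambda>_. 0"] by (simp add: root_sum_def)

lemma root_sum_on_boundary:
  assumes "x \<in> B"
  shows "root_sum B x a = of_bool (x = a) * total B"
  unfolding root_sum_def total_def forest_sum_cmult[symmetric]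
  by (rule forest_sum_cong) (simp add: forests_rooted_root[OF _ assms])

text \<open>Since \<open>b \<noteq> x\<close>, an arrow to some \<open>u\<close> leaves
  \<open>x\<close>, and \<open>x\<close> takes over the root of \<open>u\<close>. The requirement
  \<open>root \<psi> u \<noteq> x\<close> is absorbed by \<open>root \<psi> u = b\<close>.\<close>

lemma root_sum_split:
  assumes x: "x \<in> X" "x \<notin> B" "b \<noteq> x"
  shows "root_sum B x b = (\<Sum>u\<in>X. w x u / q * root_sum (insert x B) u b)"
proof -
  have "root_sum B x b = forest_sum (insert x B)
      (\<lambda>\<psi>. of_bool (root \<psi> x = b) + (\<Sum>u\<in>X. w x u / q * of_bool (root \<psi> u \<noteq> x) * of_bool (root \<psi> u = b)))"
    unfolding root_sum_def
    by (rule forest_sum_split_cong) (use x in \<open>auto simp: forests_rooted_root\<close>)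
  also have "\<dots> = forest_sum (insert x B) (\<lambda>\<psi>. \<Sum>u\<in>X. w x u / q * of_bool (root \<psi> u = b))"
    by (rule forest_sum_cong) (use x in \<open>auto simp: forests_rooted_root intro!: sum.cong\<close>)
  finally show ?thesis by (simp only: forest_sum_sum forest_sum_cmult root_sum_def)
qed

lemma root_sum_self:
  assumes x: "x \<in> X" "x \<notin> B"
  shows "root_sum B x x = total (insert x B)"
proof -
  have "root_sum B x x = forest_sum (insert x B)
      (\<lambda>\<psi>. of_bool (root \<psi> x = x) + (\<Sum>u\<in>X. w x u / q * of_bool (root \<psi> u \<noteq> x) * of_bool (root \<psi> u = x)))"
    unfolding root_sum_def
    by (rule forest_sum_split_cong) (use x in \<open>auto simp: forests_rooted_root\<close>)
  also have "\<dots> = forest_sum (insert x B) (\<lambda>_. 1)"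
    by (rule forest_sum_cong) (auto simp: forests_rooted_root intro!: sum.neutral)
  finally show ?thesis by (simp add: total_def)
qed

text \<open>Only forests in which \<open>x\<close> is a root contribute, so forcing \<open>x\<close>
  to be one loses nothing.\<close>

lemma root_sum_to:
  assumes x: "x \<in> X" "x \<notin> B" "z \<in> X"
  shows "root_sum B z x = root_sum (insert x B) z x"
proof -
  have "root_sum B z x = forest_sum (insert x B)
      (\<lambda>\<psi>. of_bool (root \<psi> z = x) + (\<Sum>u\<in>X. w x u / q * of_bool (root \<psi> u \<noteq> x) * 0))"
    unfolding root_sum_def
    by (rule forest_sum_split_cong) (use x in auto)
  then show ?thesis by (simp add: root_sum_def)
qed

text \<open>An arrow from \<open>x\<close> may point to \<open>u\<close> exactly when
  \<open>u\<close> is outside the tree of \<open>x\<close>; the difference is the mass of those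
  forests.\<close>

lemma total_split:
  assumes x: "x \<in> X" "x \<notin> B"
  shows "total B = total (insert x B)
    + (\<Sum>u\<in>X. w x u / q * (total (insert x B) - root_sum (insert x B) u x))"
proof -
  have "total B = forest_sum (insert x B)
      (\<lambda>\<psi>. 1 + (\<Sum>u\<in>X. w x u / q * of_bool (root \<psi> u \<noteq> x) * 1))"
    unfolding total_def by (rule forest_sum_split_cong) (use x in auto)
  also have "\<dots> = forest_sum (insert x B)
      (\<lambda>\<psi>. 1 + (\<Sum>u\<in>X. w x u / q * (1 + (-1) * of_bool (root \<psi> u = x))))"
    by (rule forest_sum_cong) (auto intro!: sum.cong)
  also have "\<dots> = total (insert x B)
    + (\<Sum>u\<in>X. w x u / q * (total (insert x B) + (-1) * root_sum (insert x B) u x))"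
    by (simp only: forest_sum_add forest_sum_sum forest_sum_cmult total_def root_sum_def)
  finally show ?thesis by simp
qed

text \<open>
  Here \<open>r\<close> is the root map of a forest in which \<open>x\<close> is a root, and \<open>c z\<close> is the weight \<open>w x z\<close>.
  A term with \<open>r z = x\<close> and \<open>r u = b\<close> on the left becomes, after exchanging \<open>z\<close> and \<open>u\<close>, the term
  with \<open>r z = b\<close> and \<open>r u = x\<close> that the factor \<open>r u \<noteq> x\<close> excludes.
\<close>

lemma two_arrow_exchange:
  fixes c :: "'a \<Rightarrow> real" and r :: "'a \<Rightarrow> 'a"
  assumes "b \<noteq> x"
  shows "(\<Sum>z\<in>X. c z * (of_bool (r z = b)
        + (\<Sum>u\<in>X. c u / q * of_bool (r u \<noteq> x) * of_bool ((if r z = x then r u else r z) = b))))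
    = (\<Sum>z\<in>X. c z) * (\<Sum>u\<in>X. c u / q * of_bool (r u = b)) + q * (\<Sum>u\<in>X. c u / q * of_bool (r u = b))"
proof -
  let ?\<alpha> = "\<Sum>u\<in>X. c u * of_bool (r u = b)" and ?\<kappa> = "\<Sum>u\<in>X. c u * of_bool (r u = x)"
  let ?\<sigma> = "\<Sum>u\<in>X. c u"
  have 1: "(\<Sum>u\<in>X. c u * of_bool (r u \<noteq> x)) = ?\<sigma> - ?\<kappa>"
    unfolding sum_subtractf[symmetric] by (rule sum.cong) auto
  have 2: "(\<Sum>u\<in>X. c u / q * of_bool (r u = b)) = ?\<alpha> / q"
    by (simp add: sum_divide_distrib)
  have "(\<Sum>u\<in>X. c u / q * of_bool (r u \<noteq> x) * of_bool ((if r z = x then r u else r z) = b))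
     = (of_bool (r z = b) * (?\<sigma> - ?\<kappa>) + of_bool (r z = x) * ?\<alpha>) / q" (is "?l = _") for z
  proof -
    have "?l = (\<Sum>u\<in>X. (of_bool (r z = b) * (c u * of_bool (r u \<noteq> x))
        + of_bool (r z = x) * (c u * of_bool (r u = b))) / q)"
      by (rule sum.cong) (use assms in auto)
    then show ?thesis
      by (simp only: sum_divide_distrib[symmetric] sum.distrib sum_distrib_left[symmetric] 1)
  qed
  moreover have expand: "t * (d + (d * s + k * a) / q) = t * d + t * d * (s / q) + t * k * (a / q)"
    for t d s k a :: real
    using q_pos by (simp add: field_simps)
  ultimately have "(\<Sum>z\<in>X. c z * (of_bool (r z = b)
        + (\<Sum>u\<in>X. c u / q * of_bool (r u \<noteq> x) * of_bool ((if r z = x then r u else r z) = b))))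
     = (\<Sum>z\<in>X. c z * of_bool (r z = b) + c z * of_bool (r z = b) * ((?\<sigma> - ?\<kappa>) / q)
        + c z * of_bool (r z = x) * (?\<alpha> / q))"
    by (simp only: expand)
  also have "\<dots> = ?\<alpha> + ?\<alpha> * ((?\<sigma> - ?\<kappa>) / q) + ?\<kappa> * (?\<alpha> / q)"
    by (simp only: sum.distrib sum_distrib_right[symmetric])
  also have "\<dots> = ?\<sigma> * (?\<alpha> / q) + q * (?\<alpha> / q)"
    using q_pos by (simp add: field_simps)
  finally show ?thesis unfolding 2 .
qed

text \<open>This is row \<open>x\<close> of \<open>(q - L) K = q\<close>, multiplied by
  \<open>total B\<close>; it holds only off \<open>B\<close>, whose nodes carry boundary values
  instead.\<close>

lemma root_sum_resolvent:
  assumes x: "x \<in> X" "x \<notin> B"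
  shows "q * root_sum B x b + (\<Sum>z\<in>X. w x z * (root_sum B x b - root_sum B z b))
    = q * total B * of_bool (x = b)"
proof (cases "b = x")
  case True
  let ?C = "insert x B"
  \<comment> \<open>With target \<open>x\<close>, both root sums become sums over
    \<open>insert x B\<close>, and the equation is the decomposition of
    \<open>total B\<close>.\<close>
  have "(\<Sum>z\<in>X. w x z * (root_sum B x x - root_sum B z x))
      = q * (\<Sum>z\<in>X. w x z / q * (total ?C - root_sum ?C z x))"
    unfolding sum_distrib_left
    by (rule sum.cong) (use x q_pos in \<open>simp_all add: root_sum_self root_sum_to\<close>)
  then show ?thesis
    using total_split[OF x] True x by (simp add: root_sum_self distrib_left)
next
  case False
  let ?C = "insert x B"
  \<comment> \<open>Here \<open>z\<close> is the node whose root is tested and \<open>u\<close> the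
    head of the arrow leaving \<open>x\<close>. Both carry weights from \<open>x\<close>, so they
    can be exchanged within each fixed forest \<open>\<psi>\<close>.\<close>
  have "(\<Sum>z\<in>X. w x z * root_sum B z b) = (\<Sum>z\<in>X. w x z * forest_sum ?C (\<lambda>\<psi>. of_bool (root \<psi> z = b)
     + (\<Sum>u\<in>X. w x u / q * of_bool (root \<psi> u \<noteq> x) *
           of_bool ((if root \<psi> z = x then root \<psi> u else root \<psi> z) = b))))"
    unfolding root_sum_def
    by (intro sum.cong refl arg_cong[of _ _ "(*) _"] forest_sum_split_cong) (use x in auto)
  also have "\<dots> = forest_sum ?C (\<lambda>\<psi>. \<Sum>z\<in>X. w x z * (of_bool (root \<psi> z = b)
     + (\<Sum>u\<in>X. w x u / q * of_bool (root \<psi> u \<noteq> x) *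
           of_bool ((if root \<psi> z = x then root \<psi> u else root \<psi> z) = b))))"
    by (simp only: forest_sum_sum forest_sum_cmult)
  also have "\<dots> = (\<Sum>z\<in>X. w x z) * root_sum B x b + q * root_sum B x b"
    unfolding two_arrow_exchange[OF False] root_sum_split[OF x False]
    by (simp only: forest_sum_add forest_sum_sum forest_sum_cmult root_sum_def)
  finally show ?thesis
    using False by (simp add: right_diff_distrib sum_subtractf sum_distrib_right)
qed

section \<open>Minimum principle, monotonicity in the forced roots, and the bound for two
  roots\<close>

lemma minimum_principle:
  assumes "D \<subseteq> X"
    and harm: "\<And>y. y \<in> X - D \<Longrightarrow> q * g y + (\<Sum>z\<in>X. w y z * (g y - g z)) = 0"
    and bdy: "\<And>y. y \<in> D \<Longrightarrow> g y \<ge> 0"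
    and y: "y \<in> X"
  shows "g y \<ge> 0"
proof -
  have ne: "g ` X \<noteq> {}" and fi: "finite (g ` X)" using y fin by auto
  obtain m where m: "m \<in> X" "g m = Min (g ` X)" using Min_in[OF fi ne] by auto
  have le: "g m \<le> g z" if "z \<in> X" for z using m that fi by auto
  have "g m \<ge> 0"
  proof (cases "m \<in> D")
    case False
    \<comment> \<open>At a minimiser outside \<open>D\<close> every difference is nonpositive, so
      the equation leaves \<open>q * g m \<ge> 0\<close>.\<close>
    have "(\<Sum>z\<in>X. w m z * (g m - g z)) \<le> 0"
      using w_nonneg[OF m(1)] le by (intro sum_nonpos mult_nonneg_nonpos) auto
    then have "q * g m \<ge> 0" using harm[of m] False m(1) by simp
    then show ?thesis using q_pos by (simp add: zero_le_mult_iff)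
  qed (rule bdy)
  then show ?thesis using le[OF y] by simp
qed

text \<open>The difference of the two probabilities solves the homogeneous equation off
  \<open>insert x B\<close>, because the source terms at \<open>b\<close> cancel. On
  \<open>B\<close> it is zero, and at \<open>x\<close> it is nonnegative since a forced root
  \<open>x \<noteq> b\<close> never has root \<open>b\<close>.\<close>

lemma root_prob_antimono:
  assumes B: "B \<subseteq> X" and x: "x \<in> X" "x \<notin> B" and b: "b \<noteq> x" and y: "y \<in> X"
  shows "root_sum (insert x B) y b / total (insert x B) \<le> root_sum B y b / total B"
proof -
  let ?C = "insert x B"
  have C: "?C \<subseteq> X" using B x by auto
  let ?g = "\<lambda>y. root_sum B y b / total B - root_sum ?C y b / total ?C"
  have res: "q * (root_sum A y b / total A) + (\<Sum>z\<in>X. w y z * (root_sum A y b / total A - root_sum A z b / total A))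
      = q * of_bool (y = b)" if A: "A \<subseteq> X" "y \<in> X - A" for A y
  proof -
    have "(\<Sum>z\<in>X. w y z * (root_sum A y b / total A - root_sum A z b / total A))
        = (\<Sum>z\<in>X. w y z * (root_sum A y b - root_sum A z b)) / total A"
      by (simp only: sum_divide_distrib diff_divide_distrib[symmetric] times_divide_eq_right)
    then have "q * (root_sum A y b / total A) + (\<Sum>z\<in>X. w y z * (root_sum A y b / total A - root_sum A z b / total A))
      = (q * total A * of_bool (y = b)) / total A"
      using root_sum_resolvent[of y A b] A by (simp only: add_divide_distrib[symmetric] times_divide_eq_right) auto
    then show ?thesis using total_pos[OF A(1)] by simp
  qed
  have "?g y \<ge> 0"
  proof (rule minimum_principle[OF C _ _ y])
    fix y assume y: "y \<in> X - ?C"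
    then show "q * ?g y + (\<Sum>z\<in>X. w y z * (?g y - ?g z)) = 0"
      using res[OF C y] res[OF B, of y]
      by (simp add: right_diff_distrib sum_subtractf)
  next
    fix y assume "y \<in> ?C"
    then show "?g y \<ge> 0"
      using b total_pos[OF B] total_pos[OF C]
      by (auto simp: root_sum_on_boundary root_sum_nonneg)
  qed
  then show ?thesis by simp
qed

text \<open>The \<open>x\<close> factor stays unnormalised so that \<open>root_sum_split\<close> can
  reassemble it from the heads of the arrow leaving \<open>x\<close>. The \<open>y\<close> factor is
  a probability, so that it can be compared between \<open>insert x B\<close> and
  \<open>B\<close>.\<close>

lemma pair_sum_le:
  assumes "B \<subseteq> X" "x \<in> X" "y \<in> X" "a \<noteq> b"
  shows "pair_sum B x a y b \<le> root_sum B x a * (root_sum B y b / total B)"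
  using assms
proof (induction "card (X - B)" arbitrary: B x rule: less_induct)
  case less
  note B = less.prems(1) and xX = less.prems(2) and y = less.prems(3) and ab = less.prems(4)
  have tB: "total B > 0" by (rule total_pos[OF B])
  show ?case
  proof (cases "x \<in> B")
    case True
    have "pair_sum B x a y b = of_bool (x = a) * root_sum B y b"
      unfolding pair_sum_def root_sum_def forest_sum_cmult[symmetric]
      by (rule forest_sum_cong) (simp add: forests_rooted_root[OF _ True])
    then show ?thesis using tB by (simp add: root_sum_on_boundary[OF True])
  next
    case False
    let ?C = "insert x B"
    have C: "?C \<subseteq> X" using B xX by auto
    have tC: "total ?C > 0" by (rule total_pos[OF C])
    have split: "pair_sum B x a y b = forest_sum ?C
      (\<lambda>\<psi>. of_bool (root \<psi> x = a) * of_bool (root \<psi> y = b) + (\<Sum>z\<in>X. w x z / q * of_bool (root \<psi> z \<noteq> x) *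
         (of_bool (root \<psi> z = a) * of_bool ((if root \<psi> y = x then root \<psi> z else root \<psi> y) = b))))"
      unfolding pair_sum_def
      by (rule forest_sum_split_cong) (use xX y False in \<open>auto simp: forests_rooted_root\<close>)
    show ?thesis
    proof (cases "x = a")
      case True
      \<comment> \<open>Having root \<open>a = x\<close> means that \<open>x\<close> is a root, so
        only the event for \<open>y\<close> remains.\<close>
      have "pair_sum B x a y b = root_sum ?C y b"
        unfolding split root_sum_def
        by (rule forest_sum_cong) (use True in \<open>auto simp: forests_rooted_root intro!: sum.neutral\<close>)
      also have "\<dots> = total ?C * (root_sum ?C y b / total ?C)" using tC by simp
      also have "\<dots> \<le> total ?C * (root_sum B y b / total B)"
        using root_prob_antimono[OF B xX False _ y] True ab tC by (intro mult_left_mono) auto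
      finally show ?thesis using root_sum_self[OF xX False] True by simp
    next
      case xa: False
      show ?thesis
      proof (cases "x = b")
        case True
        \<comment> \<open>If \<open>y\<close> had root \<open>b = x\<close>, then \<open>x\<close>
          would be its own root and not have root \<open>a\<close>.\<close>
        have "pair_sum B x a y b = forest_sum ?C (\<lambda>_. 0)"
          unfolding split
          by (rule forest_sum_cong) (use True xa ab in \<open>auto simp: forests_rooted_root intro!: sum.neutral\<close>)
        then show ?thesis using tB by (simp add: root_sum_nonneg)
      next
        case xb: False
        have "pair_sum B x a y b = forest_sum ?C (\<lambda>\<psi>. \<Sum>z\<in>X. w x z / q *
            (of_bool (root \<psi> z = a) * of_bool (root \<psi> y = b)))"
          unfolding split
        proof (rule forest_sum_cong)
          fix \<psi> assume "\<psi> \<in> forests_rooted ?C"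
          then have "of_bool (root \<psi> x = a) = (0::real)" using xa by (simp add: forests_rooted_root)
          \<comment> \<open>If \<open>y\<close> is in the tree of \<open>x\<close>, it inherits the
            root \<open>a \<noteq> b\<close> of \<open>z\<close>, so that branch vanishes;
            \<open>root \<psi> z = a\<close> already implies
            \<open>root \<psi> z \<noteq> x\<close>.\<close>
          moreover have "w x z / q * of_bool (root \<psi> z \<noteq> x) *
              (of_bool (root \<psi> z = a) * of_bool ((if root \<psi> y = x then root \<psi> z else root \<psi> y) = b))
            = w x z / q * (of_bool (root \<psi> z = a) * of_bool (root \<psi> y = b))" for z
            using xa xb ab by auto
          ultimately show "of_bool (root \<psi> x = a) * of_bool (root \<psi> y = b) + (\<Sum>z\<in>X. w x z / q *
              of_bool (root \<psi> z \<noteq> x) * (of_bool (root \<psi> z = a) *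
                of_bool ((if root \<psi> y = x then root \<psi> z else root \<psi> y) = b)))
            = (\<Sum>z\<in>X. w x z / q * (of_bool (root \<psi> z = a) * of_bool (root \<psi> y = b)))"
            by (simp only: mult_zero_left add_0_left)
        qed
        also have "\<dots> = (\<Sum>z\<in>X. w x z / q * pair_sum ?C z a y b)"
          by (simp only: forest_sum_sum forest_sum_cmult pair_sum_def)
        also have "\<dots> \<le> (\<Sum>z\<in>X. w x z / q * (root_sum ?C z a * (root_sum B y b / total B)))"
        proof (intro sum_mono mult_left_mono)
          fix z assume z: "z \<in> X"
          have "card (X - ?C) < card (X - B)"
            using xX False fin by (intro psubset_card_mono) auto
          from less.hyps[OF this C z y ab]
          \<comment> \<open>The induction hypothesis has both factors over \<open>?C\<close>; only
            the \<open>y\<close> factor is moved back to \<open>B\<close>.\<close>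
          show "pair_sum ?C z a y b \<le> root_sum ?C z a * (root_sum B y b / total B)"
            by (rule order_trans[OF _ mult_left_mono[OF root_prob_antimono[OF B xX False _ y]]])
               (use xb in \<open>auto simp: root_sum_nonneg\<close>)
          show "w x z / q \<ge> 0" using w_nonneg[OF xX z] q_pos by simp
        qed
        also have "\<dots> = root_sum B x a * (root_sum B y b / total B)"
          by (simp only: root_sum_split[OF xX False xa[symmetric]] sum_distrib_right mult.assoc)
        finally show ?thesis .
      qed
    qed
  qed
qed

end

subsection \<open>The Markov chain of iterated roots\<close>

lemma (in prob_space) expectation_card:
  assumes fin: "finite X" and A: "\<And>x. x \<in> X \<Longrightarrow> A x \<in> events"
  shows "expectation (\<lambda>\<omega>. real (card {x \<in> X. \<omega> \<in> A x})) = (\<Sum>x\<in>X. prob (A x))"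
proof -
  have "real (card {x \<in> X. \<omega> \<in> A x}) = (\<Sum>x\<in>X. indicator (A x) \<omega>)" for \<omega>
    using fin by (simp add: indicator_def of_bool_def sum.If_cases Int_def)
  then have "expectation (\<lambda>\<omega>. real (card {x \<in> X. \<omega> \<in> A x})) = (\<Sum>x\<in>X. expectation (indicator (A x)))"
    using A by (simp only:) (intro Bochner_Integration.integral_sum, auto simp: emeasure_eq_measure)
  also have "\<dots> = (\<Sum>x\<in>X. prob (A x))" using A by (intro sum.cong) auto
  finally show ?thesis .
qed

lemma (in prob_space) variance_card_le:
  assumes fin: "finite X" and A: "\<And>x. x \<in> X \<Longrightarrow> A x \<in> events"
    and neg: "\<And>x y. x \<in> X \<Longrightarrow> y \<in> X \<Longrightarrow> x \<noteq> y \<Longrightarrow> prob (A x \<inter> A y) \<le> prob (A x) * prob (A y)"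
  shows "variance (\<lambda>\<omega>. real (card {x \<in> X. \<omega> \<in> A x})) \<le> expectation (\<lambda>\<omega>. real (card {x \<in> X. \<omega> \<in> A x}))"
proof -
  let ?N = "\<lambda>\<omega>. \<Sum>x\<in>X. indicator (A x) \<omega> :: real"
  have card: "real (card {x \<in> X. \<omega> \<in> A x}) = ?N \<omega>" for \<omega>
    using fin by (simp add: indicator_def of_bool_def sum.If_cases Int_def)
  have E: "expectation ?N = (\<Sum>x\<in>X. prob (A x))"
    using expectation_card[of X A, OF fin] A by (simp add: card)
  have sq: "(?N \<omega>)\<^sup>2 = (\<Sum>x\<in>X. \<Sum>y\<in>X. indicator (A x \<inter> A y) \<omega>)" for \<omega>
    by (simp add: power2_eq_square sum_product indicator_inter_arith)
  have int: "integrable M (indicator (A x \<inter> A y) :: _ \<Rightarrow> real)" if "x \<in> X" "y \<in> X" for x y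
    using A that by (auto simp: emeasure_eq_measure)
  have "variance ?N = expectation (\<lambda>\<omega>. (?N \<omega>)\<^sup>2) - (expectation ?N)\<^sup>2"
    using A int by (intro variance_eq) (auto simp: sq emeasure_eq_measure intro!: Bochner_Integration.integrable_sum)
  also have "expectation (\<lambda>\<omega>. (?N \<omega>)\<^sup>2) = (\<Sum>x\<in>X. \<Sum>y\<in>X. prob (A x \<inter> A y))"
    unfolding sq using int A
    by (simp add: Bochner_Integration.integral_sum Bochner_Integration.integrable_sum)
  \<comment> \<open>Off the diagonal this is \<open>neg\<close>. On it, \<open>prob (A x)\<close> is
    bounded by itself plus a square, and the diagonal terms add up to the mean.\<close>
  also have "\<dots> \<le> (\<Sum>x\<in>X. \<Sum>y\<in>X. prob (A x) * prob (A y) + of_bool (x = y) * prob (A x))"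
    by (intro sum_mono) (use neg in \<open>auto simp: add_increasing\<close>)
  also have "\<dots> = (\<Sum>x\<in>X. prob (A x))\<^sup>2 + (\<Sum>x\<in>X. prob (A x))"
    using fin by (simp add: sum.distrib power2_eq_square sum_product of_bool_def
        if_distrib[of "\<lambda>t. t * _"] cong: if_cong)
  finally show ?thesis unfolding card E by simp
qed

lemma iter_root_in:
  assumes "finite X" "\<And>i. i < k \<Longrightarrow> F i \<in> rooted_forests X w" "x \<in> X"
  shows "iter_root X F k x \<in> X"
  using assms by (induction k) (auto intro: forest_root_in)

text \<open>The first \<open>k\<close> iterates read only the forests with index below
  \<open>k\<close>. This makes the chain a function of the restricted history, the form in which
  independence is available.\<close>

lemma iter_root_restrict:
  "k \<le> m \<Longrightarrow> iter_root X (restrict F {..<m}) k = iter_root X F k"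
  by (induction k) (auto simp: fun_eq_iff)

section \<open>The root kernel, its powers and their trace\<close>

context killed_graph
begin

definition kernel :: "'a \<Rightarrow> 'a \<Rightarrow> real" where
  "kernel x a = root_sum {} x a / total {}"

text \<open>The new factor is on the right, as in \<open>^\<^sub>m\<close> and as in the chain,
  whose latest forest acts last.\<close>

primrec kernel_pow :: "nat \<Rightarrow> 'a \<Rightarrow> 'a \<Rightarrow> real" where
  "kernel_pow 0 x a = of_bool (x = a)"
| "kernel_pow (Suc k) x a = (\<Sum>c\<in>X. kernel_pow k x c * kernel c a)"

lemma kernel_nonneg: "kernel x a \<ge> 0"
  using total_pos[of "{}"] by (simp add: kernel_def root_sum_nonneg)

lemma kernel_pow_nonneg: "kernel_pow k x a \<ge> 0"
  by (induction k arbitrary: a) (auto intro!: sum_nonneg simp: kernel_nonneg)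

lemma kernel_resolvent:
  assumes "x \<in> X"
  shows "q * kernel x b + (\<Sum>z\<in>X. w x z * (kernel x b - kernel z b)) = q * of_bool (x = b)"
proof -
  have t: "total {} > 0" by (rule total_pos) simp
  have "(\<Sum>z\<in>X. w x z * (kernel x b - kernel z b))
      = (\<Sum>z\<in>X. w x z * (root_sum {} x b - root_sum {} z b)) / total {}"
    by (simp only: kernel_def sum_divide_distrib diff_divide_distrib[symmetric] times_divide_eq_right)
  then have "q * kernel x b + (\<Sum>z\<in>X. w x z * (kernel x b - kernel z b))
      = (q * total {} * of_bool (x = b)) / total {}"
    unfolding kernel_def
    using root_sum_resolvent[of x "{}" b] assms
    by (simp only: add_divide_distrib[symmetric] times_divide_eq_right) auto
  then show ?thesis using t by simp
qed

lemma kernel_resolvent_laplacian: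
  assumes "x \<in> X"
  shows "(\<Sum>z\<in>X. (q * of_bool (x = z) - laplacian X w x z) * kernel z b) = q * of_bool (x = b)"
proof -
  have "(\<Sum>z\<in>X. (q * of_bool (x = z) - laplacian X w x z) * kernel z b)
      = (q + (\<Sum>z\<in>X - {x}. w x z)) * kernel x b - (\<Sum>z\<in>X - {x}. w x z * kernel z b)"
  proof -
    have "(\<Sum>z\<in>X - {x}. (q * of_bool (x = z) - laplacian X w x z) * kernel z b)
        = - (\<Sum>z\<in>X - {x}. w x z * kernel z b)"
      unfolding sum_negf[symmetric] by (rule sum.cong) (auto simp: laplacian_def)
    then show ?thesis
      using sum.remove[OF fin assms, of "\<lambda>z. (q * of_bool (x = z) - laplacian X w x z) * kernel z b"]
      by (simp add: laplacian_def)
  qed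
  also have "\<dots> = q * kernel x b + (\<Sum>z\<in>X. w x z * (kernel x b - kernel z b))"
    \<comment> \<open>The term \<open>z = x\<close> has a zero difference, so the sum runs over the
      other nodes, like the Laplacian.\<close>
    using sum.remove[OF fin assms, of "\<lambda>z. w x z * (kernel x b - kernel z b)"]
    by (simp add: algebra_simps sum_subtractf sum_distrib_right sum_distrib_left)
  finally show ?thesis using kernel_resolvent[OF assms] by simp
qed

lemma trace_kernel_pow:
  assumes node: "bij_betw node {..<n} X"
    and cp: "char_poly (- laplacian_mat X w n node) = (\<Prod>j<n. [:- lam j, 1:])"
  shows "(\<Sum>x\<in>X. kernel_pow k x x) = (\<Sum>j<n. (q / (q + lam j)) ^ k)"
proof -
  let ?A = "- laplacian_mat X w n node"
  let ?K = "Matrix.mat n n (\<lambda>(i, j). kernel (node i) (node j))"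
  have A: "?A \<in> carrier_mat n n" by (simp add: laplacian_mat_def)
  have K: "?K \<in> carrier_mat n n" by simp
  have nodeX: "node i \<in> X" if "i < n" for i using node that by (auto simp: bij_betw_def)
  have node_eq: "node i = node j \<longleftrightarrow> i = j" if "i < n" "j < n" for i j
    using node that by (auto simp: bij_betw_def inj_on_def)
  have reindex: "(\<Sum>m<n. f (node m)) = (\<Sum>z\<in>X. f z)" for f :: "'a \<Rightarrow> real"
    by (rule sum.reindex_bij_betw[OF node])
  have "(q \<cdot>\<^sub>m 1\<^sub>m n + ?A) * ?K = q \<cdot>\<^sub>m 1\<^sub>m n"
  proof (rule eq_matI)
    fix i j assume ij: "i < dim_row (q \<cdot>\<^sub>m 1\<^sub>m n)" "j < dim_col (q \<cdot>\<^sub>m 1\<^sub>m n)"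
    then have i: "i < n" and j: "j < n" by auto
    have "((q \<cdot>\<^sub>m 1\<^sub>m n + ?A) * ?K) $$ (i, j)
        = (\<Sum>m<n. (q \<cdot>\<^sub>m 1\<^sub>m n + ?A) $$ (i, m) * ?K $$ (m, j))"
      using A i j by (intro index_mult_mat_sum) auto
    also have "\<dots> = (\<Sum>m<n. (q * of_bool (node i = node m) - laplacian X w (node i) (node m)) * kernel (node m) (node j))"
      using i j by (intro sum.cong) (auto simp: laplacian_mat_def node_eq)
    also have "\<dots> = q * of_bool (node i = node j)"
      using reindex[of "\<lambda>z. (q * of_bool (node i = z) - laplacian X w (node i) z) * kernel z (node j)"]
      by (simp add: kernel_resolvent_laplacian[OF nodeX[OF i]])
    finally show "((q \<cdot>\<^sub>m 1\<^sub>m n + ?A) * ?K) $$ (i, j) = (q \<cdot>\<^sub>m 1\<^sub>m n) $$ (i, j)"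
      using i j by (simp add: node_eq)
  qed (auto simp: laplacian_mat_def)
  from trace_pow_resolvent[OF A K cp this]
  have "(\<Sum>i<n. (?K ^\<^sub>m k) $$ (i, i)) = (\<Sum>j<n. (q / (q + lam j)) ^ k)" using q_pos by simp
  moreover have "\<forall>i<n. \<forall>j<n. (?K ^\<^sub>m k) $$ (i, j) = kernel_pow k (node i) (node j)"
  proof (induction k)
    case 0
    then show ?case by (auto simp: node_eq)
  next
    case (Suc k)
    show ?case
    proof (intro allI impI)
      fix i j assume i: "i < n" and j: "j < n"
      have "(?K ^\<^sub>m Suc k) $$ (i, j) = (\<Sum>m<n. (?K ^\<^sub>m k) $$ (i, m) * ?K $$ (m, j))"
        using index_mult_mat_sum[OF pow_carrier_mat[OF K, of k] K i j] by simp
      also have "\<dots> = (\<Sum>m<n. kernel_pow k (node i) (node m) * kernel (node m) (node j))"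
        using Suc i j by (intro sum.cong) auto
      finally show "(?K ^\<^sub>m Suc k) $$ (i, j) = kernel_pow (Suc k) (node i) (node j)"
        by (simp add: reindex[of "\<lambda>z. kernel_pow k (node i) z * kernel z (node j)"])
    qed
  qed
  ultimately show ?thesis by (simp add: reindex[symmetric])
qed

lemma forests_rooted_empty: "forests_rooted {} = rooted_forests X w"
  by (simp add: forests_rooted_def)

lemma partition_function_eq_total: "partition_function X w q = total {}"
  by (simp add: partition_function_def total_def forest_sum_def forests_rooted_empty)

end

section \<open>Independence of the forests and the law of the chain\<close>

locale forest_chain = killed_graph X w q + prob_space M
  for X :: "'a set" and w q and M :: "'w measure" +
  fixes \<Phi> :: "nat \<Rightarrow> 'w \<Rightarrow> ('a \<times> 'a) set" and l :: nat
  assumes forests: "\<And>k. k < l \<Longrightarrow> kirchhoff_forest M X w q (\<Phi> k)"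
    and indep: "indep_vars (\<lambda>_. count_space (rooted_forests X w)) \<Phi> {..<l}"
begin

abbreviation chain :: "nat \<Rightarrow> 'w \<Rightarrow> 'a \<Rightarrow> 'a" where
  "chain k \<omega> \<equiv> iter_root X (\<lambda>i. \<Phi> i \<omega>) k"

lemma forest_measurable: "k < l \<Longrightarrow> \<Phi> k \<in> measurable M (count_space (rooted_forests X w))"
  using forests by (auto simp: kirchhoff_forest_def)

lemma forest_in: "k < l \<Longrightarrow> \<omega> \<in> space M \<Longrightarrow> \<Phi> k \<omega> \<in> rooted_forests X w"
  using measurable_space[OF forest_measurable] by auto

lemma chain_in: "k \<le> l \<Longrightarrow> \<omega> \<in> space M \<Longrightarrow> x \<in> X \<Longrightarrow> chain k \<omega> x \<in> X"
  using forest_in by (intro iter_root_in[OF fin, of _ _ w]) auto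

lemma prob_forest:
  assumes k: "k < l"
  shows "prob {\<omega> \<in> space M. S (\<Phi> k \<omega>)} = forest_sum {} (\<lambda>\<phi>. of_bool (S \<phi>)) / total {}"
proof -
  let ?F = "{\<phi> \<in> rooted_forests X w. S \<phi>}"
  have F: "finite ?F" using finite_rooted_forests[OF fin] by simp
  have ev: "{\<omega> \<in> space M. \<Phi> k \<omega> = \<phi>} \<in> events" if "\<phi> \<in> rooted_forests X w" for \<phi>
  proof -
    have "\<Phi> k -` {\<phi>} \<inter> space M \<in> events"
      using that by (intro measurable_sets[OF forest_measurable[OF k]]) simp
    then show ?thesis by (simp add: vimage_def Int_def conj_commute)
  qed
  have "{\<omega> \<in> space M. S (\<Phi> k \<omega>)} = (\<Union>\<phi>\<in>?F. {\<omega> \<in> space M. \<Phi> k \<omega> = \<phi>})"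
    using forest_in[OF k] by auto
  then have "prob {\<omega> \<in> space M. S (\<Phi> k \<omega>)} = (\<Sum>\<phi>\<in>?F. prob {\<omega> \<in> space M. \<Phi> k \<omega> = \<phi>})"
    using ev F by (simp add: finite_measure_finite_Union disjoint_family_on_def image_subset_iff Int_def)
  also have "\<dots> = (\<Sum>\<phi>\<in>?F. forest_weight X w q \<phi> / total {})"
    using forests[OF k] by (intro sum.cong) (auto simp: kirchhoff_forest_def partition_function_eq_total)
  also have "\<dots> = (\<Sum>\<phi>\<in>rooted_forests X w. forest_weight X w q \<phi> * of_bool (S \<phi>)) / total {}"
    unfolding sum_divide_distrib
    using finite_rooted_forests[OF fin] by (intro sum.mono_neutral_cong_left) auto
  finally show ?thesis by (simp add: forest_sum_def forests_rooted_empty)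
qed

text \<open>A finite product of finite discrete spaces is discrete, so \<open>Q\<close> can be any
  predicate on histories.\<close>

lemma sets_forest_product:
  assumes "finite J"
  shows "{f \<in> J \<rightarrow>\<^sub>E rooted_forests X w. Q f} \<in> sets (Pi\<^sub>M J (\<lambda>_. count_space (rooted_forests X w)))"
  using assms finite_rooted_forests[OF fin]
  by (subst count_space_PiM_finite) (auto intro: countable_finite)

lemma history_event:
  assumes "k \<le> l"
  shows "{\<omega> \<in> space M. Q (\<lambda>i\<in>{..<k}. \<Phi> i \<omega>)} \<in> events"
proof -
  have "(\<lambda>\<omega>. \<lambda>i\<in>{..<k}. \<Phi> i \<omega>) -` {f \<in> {..<k} \<rightarrow>\<^sub>E rooted_forests X w. Q f} \<inter> space M \<in> events"
    using forest_measurable assms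
    by (intro measurable_sets[OF measurable_restrict sets_forest_product]) auto
  also have "(\<lambda>\<omega>. \<lambda>i\<in>{..<k}. \<Phi> i \<omega>) -` {f \<in> {..<k} \<rightarrow>\<^sub>E rooted_forests X w. Q f} \<inter> space M
      = {\<omega> \<in> space M. Q (\<lambda>i\<in>{..<k}. \<Phi> i \<omega>)}"
    using forest_in assms by auto
  finally show ?thesis .
qed

lemma history_indep:
  assumes k: "k < l"
  shows "prob {\<omega> \<in> space M. Q (\<lambda>i\<in>{..<k}. \<Phi> i \<omega>) \<and> S (\<Phi> k \<omega>)}
    = prob {\<omega> \<in> space M. Q (\<lambda>i\<in>{..<k}. \<Phi> i \<omega>)} * prob {\<omega> \<in> space M. S (\<Phi> k \<omega>)}"
proof -
  \<comment> \<open>The single forest \<open>k\<close> is also written as a family, over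
    \<open>{k}\<close>, since independence is stated for disjoint blocks of indices.\<close>
  let ?P = "\<lambda>\<omega>. \<lambda>i\<in>{..<k}. \<Phi> i \<omega>" and ?N = "\<lambda>\<omega>. \<lambda>i\<in>{k}. \<Phi> i \<omega>"
  let ?A = "{f \<in> {..<k} \<rightarrow>\<^sub>E rooted_forests X w. Q f}" and ?B = "{f \<in> {k} \<rightarrow>\<^sub>E rooted_forests X w. S (f k)}"
  have mem: "?P \<omega> \<in> {..<k} \<rightarrow>\<^sub>E rooted_forests X w" "?N \<omega> \<in> {k} \<rightarrow>\<^sub>E rooted_forests X w"
    if "\<omega> \<in> space M" for \<omega> using forest_in that k by auto
  have "prob ((\<lambda>\<omega>. (?P \<omega>, ?N \<omega>)) -` (?A \<times> ?B) \<inter> space M) = prob (?P -` ?A \<inter> space M) * prob (?N -` ?B \<inter> space M)"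
    by (rule indep_varD[OF indep_var_restrict[OF indep] sets_forest_product sets_forest_product]) (use k in auto)
  moreover have "(\<lambda>\<omega>. (?P \<omega>, ?N \<omega>)) -` (?A \<times> ?B) \<inter> space M = {\<omega> \<in> space M. Q (?P \<omega>) \<and> S (\<Phi> k \<omega>)}"
    using mem by auto
  moreover have "?P -` ?A \<inter> space M = {\<omega> \<in> space M. Q (?P \<omega>)}" using mem by auto
  moreover have "?N -` ?B \<inter> space M = {\<omega> \<in> space M. S (\<Phi> k \<omega>)}" using mem by auto
  ultimately show ?thesis by simp
qed

lemma chain_event:
  assumes "k \<le> m" "m \<le> l"
  shows "{\<omega> \<in> space M. S (chain k \<omega>) (chain m \<omega>)} \<in> events"
  using history_event[OF assms(2), of "\<lambda>F. S (iter_root X F k) (iter_root X F m)"] assms(1)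
  by (simp only: iter_root_restrict order_refl)

lemma chain_indep:
  assumes "k < l"
  shows "prob {\<omega> \<in> space M. Q (chain k \<omega>) \<and> S (\<Phi> k \<omega>)}
    = prob {\<omega> \<in> space M. Q (chain k \<omega>)} * prob {\<omega> \<in> space M. S (\<Phi> k \<omega>)}"
  using history_indep[OF assms, of "\<lambda>F. Q (iter_root X F k)" S]
  by (simp only: iter_root_restrict order_refl)

lemma prob_partition:
  assumes C: "finite C" "\<And>\<omega>. \<omega> \<in> space M \<Longrightarrow> E \<omega> \<Longrightarrow> h \<omega> \<in> C"
    and ev: "\<And>c. c \<in> C \<Longrightarrow> {\<omega> \<in> space M. h \<omega> = c \<and> E \<omega>} \<in> events"
  shows "prob {\<omega> \<in> space M. E \<omega>} = (\<Sum>c\<in>C. prob {\<omega> \<in> space M. h \<omega> = c \<and> E \<omega>})"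
proof -
  have "{\<omega> \<in> space M. E \<omega>} = (\<Union>c\<in>C. {\<omega> \<in> space M. h \<omega> = c \<and> E \<omega>})" using C by auto
  then show ?thesis
    using finite_measure_finite_Union[of C "\<lambda>c. {\<omega> \<in> space M. h \<omega> = c \<and> E \<omega>}"] C ev
    by (auto simp: disjoint_family_on_def)
qed

lemma prob_chain:
  assumes "k \<le> l" "x \<in> X"
  shows "prob {\<omega> \<in> space M. chain k \<omega> x = a} = kernel_pow k x a"
  using assms(1)
proof (induction k arbitrary: a)
  case 0
  then show ?case by (simp add: prob_space)
next
  case (Suc k)
  have k: "k < l" using Suc.prems by simp
  have ev: "{\<omega> \<in> space M. chain k \<omega> x = c \<and> chain (Suc k) \<omega> x = a} \<in> events" for c
    by (rule chain_event[where S = "\<lambda>f g. f x = c \<and> g x = a"]) (use Suc.prems in auto)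
  have "prob {\<omega> \<in> space M. chain (Suc k) \<omega> x = a}
      = (\<Sum>c\<in>X. prob {\<omega> \<in> space M. chain k \<omega> x = c \<and> chain (Suc k) \<omega> x = a})"
    using chain_in k assms(2) ev by (intro prob_partition fin) auto
  \<comment> \<open>Replacing the random position by the constant \<open>c\<close> turns the last
    condition into one on forest \<open>k\<close> alone.\<close>
  also have "\<dots> = (\<Sum>c\<in>X. prob {\<omega> \<in> space M. chain k \<omega> x = c \<and> root (\<Phi> k \<omega>) c = a})"
    by (intro sum.cong refl arg_cong[of _ _ prob]) auto
  also have "\<dots> = (\<Sum>c\<in>X. kernel_pow k x c * kernel c a)"
  proof (rule sum.cong[OF refl])
    fix c
    have "prob {\<omega> \<in> space M. chain k \<omega> x = c \<and> root (\<Phi> k \<omega>) c = a}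
        = prob {\<omega> \<in> space M. chain k \<omega> x = c} * prob {\<omega> \<in> space M. root (\<Phi> k \<omega>) c = a}"
      by (rule chain_indep[OF k])
    then show "prob {\<omega> \<in> space M. chain k \<omega> x = c \<and> root (\<Phi> k \<omega>) c = a} = kernel_pow k x c * kernel c a"
      using Suc.IH k prob_forest[OF k, of "\<lambda>\<phi>. root \<phi> c = a"] by (simp add: kernel_def root_sum_def)
  qed
  finally show ?case by simp
qed

text \<open>The last step is split over the pair of positions \<open>(c, d)\<close>. Independence
  multiplies the induction hypothesis by the bound for one forest, and both apply when
  \<open>c \<noteq> d\<close>.\<close>

lemma prob_chain_pair_le:
  assumes "k \<le> l" "x \<in> X" "y \<in> X" "a \<noteq> b"
  shows "prob {\<omega> \<in> space M. chain k \<omega> x = a \<and> chain k \<omega> y = b} \<le> kernel_pow k x a * kernel_pow k y b"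
  using assms(1,4)
proof (induction k arbitrary: a b)
  case 0
  then show ?case by (simp add: prob_space)
next
  case (Suc k)
  have k: "k < l" using Suc.prems by simp
  let ?E = "\<lambda>c d \<omega>. chain k \<omega> x = c \<and> chain k \<omega> y = d \<and> root (\<Phi> k \<omega>) c = a \<and> root (\<Phi> k \<omega>) d = b"
  have ev: "{\<omega> \<in> space M. (chain k \<omega> x, chain k \<omega> y) = p \<and> chain (Suc k) \<omega> x = a \<and> chain (Suc k) \<omega> y = b} \<in> events" for p
    by (rule chain_event[where S = "\<lambda>f g. (f x, f y) = p \<and> g x = a \<and> g y = b"]) (use Suc.prems in auto)
  have "prob {\<omega> \<in> space M. chain (Suc k) \<omega> x = a \<and> chain (Suc k) \<omega> y = b}
      = (\<Sum>p\<in>X \<times> X. prob {\<omega> \<in> space M. (chain k \<omega> x, chain k \<omega> y) = p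
          \<and> chain (Suc k) \<omega> x = a \<and> chain (Suc k) \<omega> y = b})"
    using chain_in k assms(2,3) ev fin by (intro prob_partition) auto
  also have "\<dots> = (\<Sum>(c, d)\<in>X \<times> X. prob {\<omega> \<in> space M. ?E c d \<omega>})"
    by (intro sum.cong refl) (auto intro!: arg_cong[of _ _ prob])
  also have "\<dots> \<le> (\<Sum>(c, d)\<in>X \<times> X. (kernel_pow k x c * kernel c a) * (kernel_pow k y d * kernel d b))"
  proof (rule sum_mono, clarify)
    fix c d assume cd: "c \<in> X" "d \<in> X"
    show "prob {\<omega> \<in> space M. ?E c d \<omega>} \<le> (kernel_pow k x c * kernel c a) * (kernel_pow k y d * kernel d b)"
    proof (cases "c = d")
      case True
      \<comment> \<open>Merged trajectories share their root and so cannot end at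
        \<open>a \<noteq> b\<close>; the diagonal terms of the upper bound are simply
        nonnegative.\<close>
      then have "{\<omega> \<in> space M. ?E c d \<omega>} = {}" using Suc.prems by auto
      then show ?thesis by (simp only: measure_empty) (simp add: kernel_nonneg kernel_pow_nonneg)
    next
      case False
      have t: "total {} > 0" by (rule total_pos) simp
      have "prob {\<omega> \<in> space M. ?E c d \<omega>}
          = prob {\<omega> \<in> space M. chain k \<omega> x = c \<and> chain k \<omega> y = d} * prob {\<omega> \<in> space M. root (\<Phi> k \<omega>) c = a \<and> root (\<Phi> k \<omega>) d = b}"
        using chain_indep[OF k, of "\<lambda>f. f x = c \<and> f y = d" "\<lambda>\<phi>. root \<phi> c = a \<and> root \<phi> d = b"]
        by (simp only: conj_assoc)
      also have "prob {\<omega> \<in> space M. root (\<Phi> k \<omega>) c = a \<and> root (\<Phi> k \<omega>) d = b} = pair_sum {} c a d b / total {}"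
        unfolding prob_forest[OF k, of "\<lambda>\<phi>. root \<phi> c = a \<and> root \<phi> d = b"] by (simp add: pair_sum_def of_bool_conj)
      also have "prob {\<omega> \<in> space M. chain k \<omega> x = c \<and> chain k \<omega> y = d} * (pair_sum {} c a d b / total {})
          \<le> (kernel_pow k x c * kernel_pow k y d) * (kernel c a * kernel d b)"
      proof (rule mult_mono)
        show "prob {\<omega> \<in> space M. chain k \<omega> x = c \<and> chain k \<omega> y = d} \<le> kernel_pow k x c * kernel_pow k y d"
          using Suc.IH False k by simp
        show "pair_sum {} c a d b / total {} \<le> kernel c a * kernel d b"
          using divide_right_mono[OF pair_sum_le[of "{}" c d a b], of "total {}"] cd Suc.prems t
          by (simp add: kernel_def)
        have "pair_sum {} c a d b \<ge> 0"
          using forest_sum_mono[of "{}" "\<lambda>_. 0"] by (simp add: pair_sum_def)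
        then show "pair_sum {} c a d b / total {} \<ge> 0" using t by simp
      qed (simp add: kernel_pow_nonneg)
      finally show ?thesis by (simp add: mult_ac)
    qed
  qed
  also have "\<dots> = kernel_pow (Suc k) x a * kernel_pow (Suc k) y b"
    by (simp add: sum_product sum.cartesian_product)
  finally show ?case .
qed

end

section \<open>Mean, pair correlation and variance of the fixed nodes\<close>

theorem theorem2:
  fixes X :: "'a set" and n :: nat and w :: "'a \<Rightarrow> 'a \<Rightarrow> real"
    and node :: "nat \<Rightarrow> 'a" and lam :: "nat \<Rightarrow> real"
    and q :: real and l :: nat
    and M :: "'w measure" and \<Phi> :: "nat \<Rightarrow> 'w \<Rightarrow> ('a \<times> 'a) set"
    and \<xi> :: "nat \<Rightarrow> 'w \<Rightarrow> 'a set"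
  assumes "finite X" and "card X = n"
    and w_sym: "\<And>x y. x \<in> X \<Longrightarrow> y \<in> X \<Longrightarrow> w x y = w y x"
    and w_nonneg: "\<And>x y. x \<in> X \<Longrightarrow> y \<in> X \<Longrightarrow> w x y \<ge> 0"
    and w_diag: "\<And>x. x \<in> X \<Longrightarrow> w x x = 0"
    and node: "bij_betw node {..<n} X"
    and lam_mono: "\<And>i j. i \<le> j \<Longrightarrow> j < n \<Longrightarrow> lam i \<le> lam j"
    and lam_eigenvalues: "char_poly (- laplacian_mat X w n node) = (\<Prod>j<n. [:- lam j, 1:])"
    and "q > 0" and "l \<ge> 1"
    and "prob_space M"
    and forests: "\<And>k. k < l \<Longrightarrow> kirchhoff_forest M X w q (\<Phi> k)"
    and indep: "prob_space.indep_vars M (\<lambda>_. count_space (rooted_forests X w)) \<Phi> {..<l}"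
    and \<xi>_eq: "\<And>k \<omega>. k \<le> l \<Longrightarrow> \<xi> k \<omega> = fixed_nodes X (\<lambda>i. \<Phi> i \<omega>) k"
  shows "\<forall>k\<le>l.
      prob_space.expectation M (\<lambda>\<omega>. real (card (\<xi> k \<omega>))) = (\<Sum>j<n. (q / (q + lam j)) ^ k) \<and>
      (\<forall>x\<in>X. \<forall>y\<in>X. x \<noteq> y \<longrightarrow>
         prob_space.prob M {\<omega> \<in> space M. x \<in> \<xi> k \<omega> \<and> y \<in> \<xi> k \<omega>}
           \<le> prob_space.prob M {\<omega> \<in> space M. x \<in> \<xi> k \<omega>} * prob_space.prob M {\<omega> \<in> space M. y \<in> \<xi> k \<omega>}) \<and>
      prob_space.variance M (\<lambda>\<omega>. real (card (\<xi> k \<omega>)))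
        \<le> prob_space.expectation M (\<lambda>\<omega>. real (card (\<xi> k \<omega>)))"
proof (intro allI impI)
  interpret prob_space M by fact
  have graph: "killed_graph X w q"
    using \<open>finite X\<close> w_nonneg \<open>q > 0\<close> by unfold_locales
  interpret forest_chain X w q M \<Phi> l
    using graph forests indep \<open>prob_space M\<close>
    by (intro forest_chain.intro forest_chain_axioms.intro)
  fix k assume k: "k \<le> l"
  define A where "A = (\<lambda>x. {\<omega> \<in> space M. chain k \<omega> x = x})"
  have A: "A x \<in> events" for x
    unfolding A_def by (rule chain_event[OF order_refl k, where S = "\<lambda>f _. f x = x"])
  have prob_A: "prob (A x) = kernel_pow k x x" if "x \<in> X" for x
    unfolding A_def by (rule prob_chain[OF k that])
  have neg: "prob (A x \<inter> A y) \<le> prob (A x) * prob (A y)" if "x \<in> X" "y \<in> X" "x \<noteq> y" for x y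
  proof -
    have "A x \<inter> A y = {\<omega> \<in> space M. chain k \<omega> x = x \<and> chain k \<omega> y = y}" by (auto simp: A_def)
    then show ?thesis using prob_chain_pair_le[OF k that] that by (simp add: prob_A)
  qed
  \<comment> \<open>The sets \<open>A x\<close> lie inside \<open>space M\<close>, so the counts are
    compared only there, which suffices for integrals.\<close>
  have card: "real (card (\<xi> k \<omega>)) = real (card {x \<in> X. \<omega> \<in> A x})" if "\<omega> \<in> space M" for \<omega>
    using that by (simp add: \<xi>_eq[OF k] fixed_nodes_def A_def)
  have expect: "expectation (\<lambda>\<omega>. real (card (\<xi> k \<omega>))) = expectation (\<lambda>\<omega>. real (card {x \<in> X. \<omega> \<in> A x}))"
    by (rule Bochner_Integration.integral_cong) (auto simp: card)
  have var: "variance (\<lambda>\<omega>. real (card (\<xi> k \<omega>))) = variance (\<lambda>\<omega>. real (card {x \<in> X. \<omega> \<in> A x}))"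
    \<comment> \<open>The mean inside the variance is rewritten first; then the integrands agree
      pointwise on \<open>space M\<close>.\<close>
    unfolding expect by (rule Bochner_Integration.integral_cong) (auto simp: card)
  have "expectation (\<lambda>\<omega>. real (card (\<xi> k \<omega>))) = (\<Sum>j<n. (q / (q + lam j)) ^ k)"
    unfolding expect using trace_kernel_pow[OF node lam_eigenvalues, of k] A prob_A
    by (simp add: expectation_card[OF \<open>finite X\<close>])
  moreover have "prob {\<omega> \<in> space M. x \<in> \<xi> k \<omega> \<and> y \<in> \<xi> k \<omega>}
      \<le> prob {\<omega> \<in> space M. x \<in> \<xi> k \<omega>} * prob {\<omega> \<in> space M. y \<in> \<xi> k \<omega>}"
    if "x \<in> X" "y \<in> X" "x \<noteq> y" for x y
  proof -
    have "{\<omega> \<in> space M. x \<in> \<xi> k \<omega> \<and> y \<in> \<xi> k \<omega>} = A x \<inter> A y"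
      "{\<omega> \<in> space M. x \<in> \<xi> k \<omega>} = A x" "{\<omega> \<in> space M. y \<in> \<xi> k \<omega>} = A y"
      using that by (auto simp: \<xi>_eq[OF k] fixed_nodes_def A_def)
    then show ?thesis using neg[OF that] by simp
  qed
  moreover have "variance (\<lambda>\<omega>. real (card (\<xi> k \<omega>))) \<le> expectation (\<lambda>\<omega>. real (card (\<xi> k \<omega>)))"
    unfolding var unfolding expect using A neg by (intro variance_card_le[OF \<open>finite X\<close>])
  ultimately show "expectation (\<lambda>\<omega>. real (card (\<xi> k \<omega>))) = (\<Sum>j<n. (q / (q + lam j)) ^ k) \<and>
      (\<forall>x\<in>X. \<forall>y\<in>X. x \<noteq> y \<longrightarrow> prob {\<omega> \<in> space M. x \<in> \<xi> k \<omega> \<and> y \<in> \<xi> k \<omega>}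
           \<le> prob {\<omega> \<in> space M. x \<in> \<xi> k \<omega>} * prob {\<omega> \<in> space M. y \<in> \<xi> k \<omega>}) \<and>
      variance (\<lambda>\<omega>. real (card (\<xi> k \<omega>))) \<le> expectation (\<lambda>\<omega>. real (card (\<xi> k \<omega>)))"
    by blast
qed

end
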